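(* Let $X,Y$ be complex Banach spaces and let $A\in\mathcal{B}(X)$, $B\in\mathcal{B}(Y)$ be isoloid operators with the SVEP. If $A$ and $B$ obey generalized Weyl's theorem, then for every $C\in\mathcal{B}(Y,X)$ the operator $$M_C=\begin{bmatrix}A&C\\0&B\end{bmatrix}$$ on $X\oplus Y$ obeys generalized Weyl's theorem.
   Context: $\mathcal{B}(Y,X)$ is the space of bounded linear operators $Y\to X$, $\mathcal{B}(X)=\mathcal{B}(X,X)$. $T$ has the single-valued extension property (SVEP) if for every $\lambda_0\in\mathbb{C}$ and every open disc $D$ centered at $\lambda_0$ the only analytic vector-valued $f$ on $D$ with $(T-\lambda)f(\lambda)=0$ for all $\lambda\in D$ is $f\equiv0$. $T$ is isoloid if every isolated point of $\sigma(T)$ is an eigenvalue of $T$. For an integer $n\ge0$, $T_{[n]}$ is the restriction of $T$ to its range $R(T^n)$, viewed as a map $R(T^n)\to R(T^n)$; $T$ is B-Fredholm if for some $n\ge 0$, $R(T^n)$ is closed and $T_{[n]}$ is Fredholm, and then its index is that of $T_{[n]}$ (independent of such $n$). $T$ is B-Weyl if it is B-Fredholm of index $0$, and $\sigma_{BW}(T)=\{\lambda\in\mathbb{C}: T-\lambda I\text{ is not B-Weyl}\}$. $E(T)$ is the set of eigenvalues of $T$ that are isolated points of $\sigma(T)$. $T$ obeys generalized Weyl's theorem if $\sigma(T)\setminus E(T)=\sigma_{BW}(T)$. *)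

theory Defs
  imports "HOL-Analysis.Analysis"
begin

class complex_normed_vector = real_normed_vector +
  fixes scaleC :: "complex \<Rightarrow> 'a \<Rightarrow> 'a" (infixr \<open>*\<^sub>C\<close> 75)
  assumes scaleC_add_right: "a *\<^sub>C (x + y) = a *\<^sub>C x + a *\<^sub>C y"
    and scaleC_add_left: "(a + b) *\<^sub>C x = a *\<^sub>C x + b *\<^sub>C x"
    and scaleC_scaleC: "a *\<^sub>C b *\<^sub>C x = (a * b) *\<^sub>C x"
    and scaleC_one: "1 *\<^sub>C x = x"
    and scaleR_scaleC: "r *\<^sub>R x = complex_of_real r *\<^sub>C x"
    and norm_scaleC: "norm (a *\<^sub>C x) = cmod a * norm x"

class complex_banach = complex_normed_vector + complete_space

subclass (in complex_banach) banach ..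

global_interpretation complex_vector:
  vector_space "scaleC :: complex \<Rightarrow> 'a \<Rightarrow> 'a::complex_normed_vector"
  by standard (simp_all add: scaleC_add_right scaleC_add_left scaleC_scaleC scaleC_one)

text \<open>The direct sum of two spaces is the product type. Its library norm is the Euclidean one,
  which is equivalent to the sum and maximum norms; all notions below depend only on the
  topology and the linear structure.\<close>

instantiation prod :: (complex_normed_vector, complex_normed_vector) complex_normed_vector
begin

definition scaleC_prod :: "complex \<Rightarrow> 'a \<times> 'b \<Rightarrow> 'a \<times> 'b"
  where "scaleC_prod a p = (a *\<^sub>C fst p, a *\<^sub>C snd p)"

instance
proof
  fix a b :: complex and x y :: "'a \<times> 'b" and r :: real
  show "a *\<^sub>C (x + y) = a *\<^sub>C x + a *\<^sub>C y"
    by (simp add: scaleC_prod_def scaleC_add_right)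
  show "(a + b) *\<^sub>C x = a *\<^sub>C x + b *\<^sub>C x"
    by (simp add: scaleC_prod_def scaleC_add_left)
  show "a *\<^sub>C b *\<^sub>C x = (a * b) *\<^sub>C x"
    by (simp add: scaleC_prod_def scaleC_scaleC)
  show "1 *\<^sub>C x = x"
    by (simp add: scaleC_prod_def scaleC_one)
  show "r *\<^sub>R x = complex_of_real r *\<^sub>C x"
    by (simp add: scaleC_prod_def scaleR_prod_def scaleR_scaleC)
  have "(cmod a * norm (fst x))\<^sup>2 + (cmod a * norm (snd x))\<^sup>2
      = (cmod a)\<^sup>2 * ((norm (fst x))\<^sup>2 + (norm (snd x))\<^sup>2)"
    by (simp add: power_mult_distrib distrib_left)
  then show "norm (a *\<^sub>C x) = cmod a * norm x"
    by (simp add: scaleC_prod_def norm_prod_def norm_scaleC real_sqrt_mult)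
qed

end

instance prod :: (complex_banach, complex_banach) complex_banach ..

definition bounded_clinear ::
    "('a::complex_normed_vector \<Rightarrow> 'b::complex_normed_vector) \<Rightarrow> bool"
  where "bounded_clinear T \<longleftrightarrow>
    bounded_linear T \<and> (\<forall>c x. T (c *\<^sub>C x) = c *\<^sub>C T x)"

definition shift_op ::
    "('a::complex_normed_vector \<Rightarrow> 'a) \<Rightarrow> complex \<Rightarrow> 'a \<Rightarrow> 'a"
  where "shift_op T l = (\<lambda>x. T x - l *\<^sub>C x)"

definition spectrum :: "('a::complex_normed_vector \<Rightarrow> 'a) \<Rightarrow> complex set"
  where "spectrum T = {l. \<not> (\<exists>S. bounded_clinear S \<and>
    S \<circ> shift_op T l = id \<and> shift_op T l \<circ> S = id)}"

definition eigenvalue :: "('a::complex_normed_vector \<Rightarrow> 'a) \<Rightarrow> complex \<Rightarrow> bool"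
  where "eigenvalue T l \<longleftrightarrow> (\<exists>x. x \<noteq> 0 \<and> T x = l *\<^sub>C x)"

text \<open>Vector-valued analogues of the library's predicates for functions between complex numbers:
  a Frechet derivative of the form \<open>h \<mapsto> h d\<close> is a complex derivative \<open>d\<close>.\<close>

definition vec_holomorphic_on ::
    "(complex \<Rightarrow> 'a::complex_normed_vector) \<Rightarrow> complex set \<Rightarrow> bool"
  where "vec_holomorphic_on f S \<longleftrightarrow>
    (\<forall>z\<in>S. \<exists>d. (f has_derivative (\<lambda>h. h *\<^sub>C d)) (at z within S))"

definition vec_analytic_on ::
    "(complex \<Rightarrow> 'a::complex_normed_vector) \<Rightarrow> complex set \<Rightarrow> bool"
  where "vec_analytic_on f S \<longleftrightarrow>
    (\<forall>z\<in>S. \<exists>e>0. vec_holomorphic_on f (ball z e))"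

definition svep :: "('a::complex_normed_vector \<Rightarrow> 'a) \<Rightarrow> bool"
  where "svep T \<longleftrightarrow> (\<forall>l\<^sub>0. \<forall>r>0. \<forall>f.
    vec_analytic_on f (ball l\<^sub>0 r) \<and> (\<forall>l\<in>ball l\<^sub>0 r. shift_op T l (f l) = 0)
      \<longrightarrow> (\<forall>l\<in>ball l\<^sub>0 r. f l = 0))"

definition isoloid :: "('a::complex_normed_vector \<Rightarrow> 'a) \<Rightarrow> bool"
  where "isoloid T \<longleftrightarrow> (\<forall>l. l isolated_in spectrum T \<longrightarrow> eigenvalue T l)"

text \<open>For subspaces \<open>R \<subseteq> W\<close>, the cosets of the vectors in \<open>B \<subseteq> W\<close> span
  the quotient \<open>W / R\<close> iff \<open>W\<close> is the span of \<open>R \<union> B\<close>. So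
  \<open>quot_dim W R\<close> is the dimension of \<open>W / R\<close>, provided that is finite.\<close>

definition quot_spanning ::
    "'a::complex_normed_vector set \<Rightarrow> 'a set \<Rightarrow> 'a set \<Rightarrow> bool"
  where "quot_spanning W R B \<longleftrightarrow> B \<subseteq> W \<and> complex_vector.span (R \<union> B) = W"

definition quot_finite_dim :: "'a::complex_normed_vector set \<Rightarrow> 'a set \<Rightarrow> bool"
  where "quot_finite_dim W R \<longleftrightarrow> (\<exists>B. finite B \<and> quot_spanning W R B)"

definition quot_dim :: "'a::complex_normed_vector set \<Rightarrow> 'a set \<Rightarrow> nat"
  where "quot_dim W R = (LEAST n. \<exists>B. finite B \<and> card B = n \<and> quot_spanning W R B)"

definition finite_dim :: "'a::complex_normed_vector set \<Rightarrow> bool"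
  where "finite_dim N \<longleftrightarrow> (\<exists>B. finite B \<and> complex_vector.span B = N)"

text \<open>In the next two definitions \<open>W\<close> is a subspace with \<open>T ` W \<subseteq> W\<close>, and
  the operator concerned is the restriction of \<open>T\<close> to a map from \<open>W\<close> to \<open>W\<close>.
  For closed \<open>W\<close> and bounded \<open>T\<close>, finite codimension of the range makes it
  closed, so closedness is not listed as a separate condition.\<close>

definition fredholm_on ::
    "'a::complex_normed_vector set \<Rightarrow> ('a \<Rightarrow> 'a) \<Rightarrow> bool"
  where "fredholm_on W T \<longleftrightarrow>
    finite_dim {x\<in>W. T x = 0} \<and> quot_finite_dim W (T ` W)"

definition index_on ::
    "'a::complex_normed_vector set \<Rightarrow> ('a \<Rightarrow> 'a) \<Rightarrow> int"
  where "index_on W T =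
    int (complex_vector.dim {x\<in>W. T x = 0}) - int (quot_dim W (T ` W))"

text \<open>The index of a B-Fredholm operator does not depend on the exponent \<open>n\<close> used to
  compute it, so it is given here as a relation.\<close>

definition b_fredholm_index :: "('a::complex_normed_vector \<Rightarrow> 'a) \<Rightarrow> int \<Rightarrow> bool"
  where "b_fredholm_index T k \<longleftrightarrow> (\<exists>n::nat. closed (range (T ^^ n)) \<and>
    fredholm_on (range (T ^^ n)) T \<and> index_on (range (T ^^ n)) T = k)"

definition b_fredholm :: "('a::complex_normed_vector \<Rightarrow> 'a) \<Rightarrow> bool"
  where "b_fredholm T \<longleftrightarrow> (\<exists>n::nat. closed (range (T ^^ n)) \<and>
    fredholm_on (range (T ^^ n)) T)"

definition b_weyl :: "('a::complex_normed_vector \<Rightarrow> 'a) \<Rightarrow> bool"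
  where "b_weyl T \<longleftrightarrow> b_fredholm T \<and> b_fredholm_index T 0"

definition b_weyl_spectrum :: "('a::complex_normed_vector \<Rightarrow> 'a) \<Rightarrow> complex set"
  where "b_weyl_spectrum T = {l. \<not> b_weyl (shift_op T l)}"

definition isolated_eigenvalues :: "('a::complex_normed_vector \<Rightarrow> 'a) \<Rightarrow> complex set"
  where "isolated_eigenvalues T = {l. eigenvalue T l \<and> l isolated_in spectrum T}"

definition generalized_weyl :: "('a::complex_normed_vector \<Rightarrow> 'a) \<Rightarrow> bool"
  where "generalized_weyl T \<longleftrightarrow>
    spectrum T - isolated_eigenvalues T = b_weyl_spectrum T"

definition upper_triangular_op ::
    "('a \<Rightarrow> 'a) \<Rightarrow> ('b \<Rightarrow> 'a) \<Rightarrow> ('b \<Rightarrow> 'b) \<Rightarrow>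
      'a::complex_normed_vector \<times> 'b::complex_normed_vector \<Rightarrow> 'a \<times> 'b"
  where "upper_triangular_op A C B = (\<lambda>(x, y). (A x + C y, B y))"

end

theory Submission
  imports Defs
begin

text \<open>An operator with the SVEP whose shift \<open>T - l\<close> is B-Weyl has finite ascent and descent
  at \<open>l\<close>. Indeed, let \<open>V\<^sub>k\<close> be the range of \<open>(T - l)^(k + n)\<close>, where the restriction to
  \<open>V\<^sub>0\<close> is Fredholm of index 0. The finite-dimensional kernels of \<open>T - l\<close> on
  \<open>V\<^sub>k\<close> stabilise, hence \<open>T - l\<close> maps the intersection of all \<open>V\<^sub>k\<close> onto itself.
  A nonzero kernel vector in that intersection would start a bounded chain of preimages, whose
  generating power series is an analytic eigenvector, against the SVEP. So the kernels vanish for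
  large \<open>k\<close>, and index 0 then forces \<open>V\<^sub>k\<^sub>+\<^sub>1 = V\<^sub>k\<close>.

  Conversely, finite ascent and descent make \<open>T - l\<close> B-Weyl, and make \<open>l\<close> an isolated
  eigenvalue if it is a spectral value. Now \<open>M\<^sub>C\<close> inherits the SVEP, its spectrum is the
  union of those of \<open>A\<close> and \<open>B\<close> because a surjective operator with the SVEP is
  bijective, and it inherits finite ascent and descent from \<open>A\<close> and \<open>B\<close>. An isolated
  point of the union is, in each of the two spectra, isolated or absent, so that the hypotheses
  on \<open>A\<close> and \<open>B\<close> apply there.\<close>

section \<open>Open mappings and closed ranges\<close>

text \<open>Banach's argument: Baire category gives approximate preimages, and successive
  approximation makes them exact. It is stated for closed subspaces because it is applied to
  restrictions of operators to ranges of powers; the constant \<open>K\<close> later controls the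
  growth of chains of preimages.\<close>

lemma open_mapping_subspace:
  fixes T :: "'a::banach \<Rightarrow> 'b::banach"
  assumes T: "bounded_linear T"
    and V: "closed V" "subspace V" and W: "closed W" and TV: "T ` V = W"
  shows "\<exists>K>0. \<forall>y\<in>W. \<exists>x\<in>V. T x = y \<and> norm x \<le> K * norm y"
proof -
  interpret T: bounded_linear T by (rule T)
  have W': "subspace W"
    using TV T.linear V(2) linear_subspace_image by blast
  define C where "C n = closure (T ` (V \<inter> cball 0 (real n)))" for n
  have CW: "C n \<subseteq> W" for n
    unfolding C_def by (rule closure_minimal) (use TV W in auto)
  \<comment> \<open>The closed set \<open>W\<close> is completely metrizable and is covered by the
    countably many closed sets \<open>C n\<close>, so they cannot all have empty interior in
    \<open>W\<close>.\<close>
  have "\<exists>n. top_of_set W interior_of C n \<noteq> {}"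
  proof (rule ccontr)
    assume *: "\<not> ?thesis"
    have "top_of_set W interior_of \<Union> (range C) = {}"
    proof (rule Baire_category_alt)
      show "completely_metrizable_space (top_of_set W) \<or>
        locally_compact_space (top_of_set W) \<and> regular_space (top_of_set W)"
        using W closed_closedin completely_metrizable_space_closedin completely_metrizable_space_euclidean by blast
      fix D assume "D \<in> range C"
      then obtain n where "D = C n" by blast
      moreover have "closedin (top_of_set W) (C n)"
        using CW by (intro closed_subset) (simp_all add: C_def)
      ultimately show "closedin (top_of_set W) D \<and> top_of_set W interior_of D = {}"
        using * by blast
    qed auto
    moreover have "\<Union> (range C) = W"
    proof
      show "W \<subseteq> \<Union> (range C)"
      proof
        fix y assume "y \<in> W"
        then obtain x where x: "x \<in> V" "y = T x" using TV by auto
        obtain n where "norm x \<le> real n" using real_arch_simple by blast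
        with x have "y \<in> C n" unfolding C_def by (intro subsetD[OF closure_subset]) auto
        then show "y \<in> \<Union> (range C)" by auto
      qed
    qed (use CW in auto)
    ultimately have "W = {}"
      by (metis interior_of_topspace topspace_euclidean_subtopology)
    then show False using subspace_0[OF W'] by auto
  qed
  then obtain n y0 where "y0 \<in> top_of_set W interior_of C n" by auto
  then obtain U where U: "openin (top_of_set W) U" "y0 \<in> U" "U \<subseteq> C n"
    by (auto simp: interior_of_def)
  then obtain e where e: "e > 0" "ball y0 e \<inter> W \<subseteq> C n" and y0: "y0 \<in> W"
    by (metis (no_types, lifting) openin_contains_ball subset_iff)
  \<comment> \<open>Scaled to norm \<open>e / 2\<close>, a vector of \<open>W\<close> is a
    difference of two points of \<open>C n\<close>, hence nearly \<open>T (a - b)\<close> with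
    \<open>norm (a - b) \<le> 2 * n\<close>. Undoing the scaling gives the factor
    \<open>4 * n / e\<close>; adding 1 keeps \<open>M\<close> positive if \<open>n = 0\<close>. The
    two errors \<open>e / 8\<close> add up to \<open>norm y / 2\<close> after rescaling.\<close>
  define M where "M = 4 * real n / e + 1"
  have M: "M > 0" unfolding M_def using e by (simp add: add_nonneg_pos)
  have approx: "\<exists>x\<in>V. norm x \<le> M * norm y \<and> norm (y - T x) \<le> norm y / 2" if y: "y \<in> W" for y
  proof (cases "y = 0")
    case True
    then show ?thesis using subspace_0[OF V(2)] T.zero by (intro bexI[of _ 0]) auto
  next
    case False
    define c where "c = e / (2 * norm y)"
    have c: "c > 0" using False e by (simp add: c_def)
    have cy: "norm (c *\<^sub>R y) = e / 2" using False e by (simp add: c_def)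
    have "y0 + c *\<^sub>R y \<in> C n" "y0 \<in> C n"
      using cy e y0 y W' by (auto intro!: subsetD[OF e(2)] simp: dist_norm subspace_add subspace_scale)
    then have "\<exists>z\<in>T ` (V \<inter> cball 0 n). dist z (y0 + c *\<^sub>R y) < e / 8"
      "\<exists>z\<in>T ` (V \<inter> cball 0 n). dist z y0 < e / 8"
      unfolding C_def closure_approachable using e(1) by (meson divide_pos_pos zero_less_numeral)+
    then obtain a b where a: "a \<in> V" "norm a \<le> n" "dist (T a) (y0 + c *\<^sub>R y) < e / 8"
      and b: "b \<in> V" "norm b \<le> n" "dist (T b) y0 < e / 8"
      by auto
    let ?x = "(1 / c) *\<^sub>R (a - b)"
    have "norm (a - b) \<le> 2 * n" using norm_triangle_ineq4[of a b] a b by linarith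
    then have "norm ?x \<le> (1 / c) * (2 * n)" using c by (simp add: divide_right_mono)
    also have "\<dots> = (4 * n / e) * norm y" using False e by (simp add: c_def field_simps)
    also have "\<dots> \<le> M * norm y" by (simp add: M_def algebra_simps)
    finally have 1: "norm ?x \<le> M * norm y" .
    have "norm (c *\<^sub>R y - T (a - b)) = norm ((y0 + c *\<^sub>R y - T a) - (y0 - T b))"
      by (simp add: T.diff algebra_simps)
    also have "\<dots> \<le> e / 8 + e / 8"
      using norm_triangle_ineq4[of "y0 + c *\<^sub>R y - T a" "y0 - T b"] a(3) b(3)
      by (simp add: dist_norm norm_minus_commute)
    finally have 2: "norm (c *\<^sub>R y - T (a - b)) \<le> e / 4" by simp
    have "norm (y - T ?x) = norm ((1 / c) *\<^sub>R (c *\<^sub>R y - T (a - b)))"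
      unfolding T.scaleR scaleR_right_diff_distrib[of "1 / c" "c *\<^sub>R y"] using c by simp
    also have "\<dots> = (1 / c) * norm (c *\<^sub>R y - T (a - b))" using c by simp
    also have "\<dots> \<le> (1 / c) * (e / 4)" using 2 c by (intro mult_left_mono) auto
    also have "\<dots> = norm y / 2" using False e by (simp add: c_def)
    finally show ?thesis using 1 a b V by (intro bexI[of _ ?x]) (auto simp: subspace_scale subspace_diff)
  qed
  then obtain g where g: "\<And>y. y \<in> W \<Longrightarrow> g y \<in> V \<and> norm (g y) \<le> M * norm y \<and> norm (y - T (g y)) \<le> norm y / 2"
    by metis
  have "\<exists>x\<in>V. T x = y \<and> norm x \<le> (2 * M) * norm y" if y: "y \<in> W" for y
  proof -
    \<comment> \<open>\<open>s k\<close> is the residual after \<open>k\<close> corrections. It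
      halves each time, so the corrections \<open>g (s k)\<close> are summable, and telescoping
      shows that their sum is an exact preimage of \<open>y\<close>.\<close>
    define s where "s k = ((\<lambda>z. z - T (g z)) ^^ k) y" for k
    have s0: "s 0 = y" and sS: "s (Suc k) = s k - T (g (s k))" for k by (simp_all add: s_def)
    have sW: "s k \<in> W" for k
    proof (induction k)
      case (Suc k)
      then have "T (g (s k)) \<in> W" using g TV by blast
      then show ?case using Suc W' by (simp add: sS subspace_diff)
    qed (simp add: s0 y)
    have sn: "norm (s k) \<le> norm y * (1/2) ^ k" for k
    proof (induction k)
      case (Suc k)
      then show ?case using g[OF sW[of k]] by (simp add: sS)
    qed (simp add: s0)
    have gn: "norm (g (s k)) \<le> (M * norm y) * (1/2) ^ k" for k
      using g[OF sW[of k]] mult_left_mono[OF sn[of k] less_imp_le[OF M]] by (simp only: mult.assoc) linarith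
    have geo: "(\<lambda>k. (M * norm y) * (1/2) ^ k) sums ((M * norm y) * 2)"
      using sums_mult[OF geometric_sums[of "1/2::real"]] by simp
    have sg: "summable (\<lambda>k. norm (g (s k)))"
      by (rule summable_comparison_test'[OF sums_summable[OF geo], of 0]) (use gn in simp)
    define x where "x = (\<Sum>k. g (s k))"
    have x: "(\<lambda>k. g (s k)) sums x"
      unfolding x_def by (intro summable_sums summable_norm_cancel[OF sg])
    have "norm x \<le> (\<Sum>k. norm (g (s k)))" unfolding x_def by (rule summable_norm[OF sg])
    also have "\<dots> \<le> (M * norm y) * 2"
      using suminf_le[OF gn sg sums_summable[OF geo]] sums_unique[OF geo] by simp
    finally have 1: "norm x \<le> (2 * M) * norm y" by (simp add: mult_ac)
    have "x \<in> V"
      using x unfolding sums_def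
      by (rule closed_sequentially[OF V(1), rotated]) (use g sW V in \<open>auto intro: subspace_sum\<close>)
    moreover have "T x = y"
    proof -
      have "s \<longlonglongrightarrow> 0"
      proof (rule Lim_null_comparison)
        show "\<forall>\<^sub>F k in sequentially. norm (s k) \<le> norm y * (1/2) ^ k" using sn by simp
        show "(\<lambda>k. norm y * (1/2) ^ k) \<longlonglongrightarrow> 0" by real_asymp
      qed
      then have "(\<lambda>k. s k - s (Suc k)) sums (s 0 - 0)" by (rule telescope_sums')
      then have "(\<lambda>k. T (g (s k))) sums y" by (simp add: sS s0)
      with T.sums[OF x] show ?thesis by (rule sums_unique2)
    qed
    ultimately show ?thesis using 1 by auto
  qed
  then show ?thesis using M by (intro exI[of _ "2 * M"]) auto
qed

section \<open>Closedness of finite-dimensional extensions and of complemented ranges\<close>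

lemma subspace_if_complex_subspace:
  "complex_vector.subspace V \<Longrightarrow> subspace V"
  by (simp add: complex_vector.subspace_def subspace_def scaleR_scaleC)

lemma bounded_linear_scaleC_left: "bounded_linear (\<lambda>c. c *\<^sub>C (x::'a::complex_normed_vector))"
  by (rule bounded_linear_intro[where K = "norm x"])
    (simp_all add: scaleC_add_left norm_scaleC scaleR_scaleC scaleC_scaleC scaleR_conv_of_real)

lemma bounded_linear_scaleC_right: "bounded_linear (\<lambda>x::'a::complex_normed_vector. c *\<^sub>C x)"
  by (rule bounded_linear_intro[where K = "cmod c"])
    (simp_all add: scaleC_add_right norm_scaleC scaleR_scaleC scaleC_scaleC mult.commute)

text \<open>The distance \<open>\<delta>\<close> from \<open>b\<close> to \<open>V\<close> is
  positive and bounds the coefficient of \<open>b\<close> by the norm of the vector divided by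
  \<open>\<delta>\<close>. So along a convergent sequence the coefficients of \<open>b\<close> are
  Cauchy, and the remaining parts converge within \<open>V\<close>.\<close>

lemma closed_span_insert:
  fixes V :: "'a::complex_normed_vector set"
  assumes V: "closed V" "complex_vector.subspace V"
  shows "closed (complex_vector.span (insert b V))"
proof (cases "b \<in> V")
  case True
  then show ?thesis using V by (simp add: insert_absorb complex_vector.span_eq_iff[THEN iffD2])
next
  case False
  have V0: "0 \<in> V" using V(2) by (rule complex_vector.subspace_0)
  define \<delta> where "\<delta> = infdist b V"
  have \<delta>: "\<delta> > 0" unfolding \<delta>_def using False V(1) V0
    using in_closed_iff_infdist_zero infdist_nonneg less_eq_real_def by fastforce
  have bound: "cmod c * \<delta> \<le> norm (v + c *\<^sub>C b)" if "v \<in> V" for v c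
  proof (cases "c = 0")
    case c: False
    define w where "w = (- 1 / c) *\<^sub>C v"
    have "w \<in> V" unfolding w_def using V(2) that by (rule complex_vector.subspace_scale)
    then have "\<delta> \<le> norm (b - w)" unfolding \<delta>_def using infdist_le by (metis dist_norm)
    then have "cmod c * \<delta> \<le> norm (c *\<^sub>C (b - w))" by (simp add: norm_scaleC mult_left_mono)
    also have "c *\<^sub>C (b - w) = v + c *\<^sub>C b"
      using c by (simp add: w_def complex_vector.scale_right_distrib scaleC_scaleC scaleC_one)
    finally show ?thesis .
  qed simp
  have "z \<in> complex_vector.span (insert b V)"
    if f: "\<And>n. f n \<in> complex_vector.span (insert b V)" "f \<longlonglongrightarrow> z" for f z
  proof -
    have "\<exists>c. f n - c *\<^sub>C b \<in> V" for n
      using f(1)[of n] V(2) by (auto simp: complex_vector.span_insert complex_vector.span_eq_iff[THEN iffD2])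
    then obtain c where c: "\<And>n. f n - c n *\<^sub>C b \<in> V" by metis
    have "cmod (c m - c n) * \<delta> \<le> norm (f m - f n)" for m n
    proof -
      have "(f m - c m *\<^sub>C b) - (f n - c n *\<^sub>C b) \<in> V"
        by (rule complex_vector.subspace_diff[OF V(2) c c])
      from bound[OF this, of "c m - c n"] show ?thesis
        by (simp add: complex_vector.scale_left_diff_distrib)
    qed
    then have le: "dist (c m) (c n) \<le> dist (f m) (f n) / \<delta>" for m n
      using \<delta> by (simp add: dist_norm field_simps)
    have "Cauchy c"
    proof (rule metric_CauchyI)
      fix e :: real assume "e > 0"
      then obtain N where "\<And>m n. m \<ge> N \<Longrightarrow> n \<ge> N \<Longrightarrow> dist (f m) (f n) < e * \<delta>"
        using metric_CauchyD[OF LIMSEQ_imp_Cauchy[OF f(2)], of "e * \<delta>"] \<delta> by auto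
      then show "\<exists>M. \<forall>m\<ge>M. \<forall>n\<ge>M. dist (c m) (c n) < e"
        using le \<delta> by (meson le_less_trans pos_divide_less_eq)
    qed
    then obtain l where l: "c \<longlonglongrightarrow> l" using Cauchy_convergent_iff convergentD by blast
    have "(\<lambda>n. f n - c n *\<^sub>C b) \<longlonglongrightarrow> z - l *\<^sub>C b"
      by (intro tendsto_diff f(2) bounded_linear.tendsto[OF bounded_linear_scaleC_left] l)
    then have "z - l *\<^sub>C b \<in> V"
      by (rule closed_sequentially[OF V(1) c])
    then show ?thesis
      unfolding complex_vector.span_insert using complex_vector.span_base by blast
  qed
  then show ?thesis unfolding closed_sequential_limits by blast
qed

lemma closed_span_finite:
  fixes B :: "'a::complex_normed_vector set"
  assumes "finite B"
  shows "closed (complex_vector.span B)"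
  using assms
proof (induction B)
  case (insert b B)
  have "complex_vector.span (insert b (complex_vector.span B)) = complex_vector.span (insert b B)"
    by (simp add: complex_vector.span_insert complex_vector.span_span)
  then show ?case using closed_span_insert[OF insert.IH complex_vector.subspace_span, of b] by simp
qed simp

text \<open>The open mapping theorem is applied to \<open>(v, f) \<mapsto> T v + f\<close> on
  \<open>V \<times> F\<close>. Although \<open>v\<close> need not be unique, the component in
  \<open>F\<close> is, and so its norm is at most \<open>K\<close> times that of the sum.\<close>

lemma closed_image_complemented:
  fixes T :: "'a::banach \<Rightarrow> 'b::banach"
  assumes T: "bounded_linear T" and V: "closed V" "subspace V"
    and F: "closed F" "subspace F" and W: "closed W"
    and sum: "{T v + f |v f. v \<in> V \<and> f \<in> F} = W" and int: "T ` V \<inter> F \<subseteq> {0}"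
  shows "closed (T ` V)"
proof -
  interpret T: bounded_linear T by (rule T)
  let ?P = "\<lambda>p. T (fst p) + snd p"
  have "\<exists>K>0. \<forall>y\<in>W. \<exists>p\<in>V \<times> F. ?P p = y \<and> norm p \<le> K * norm y"
  proof (rule open_mapping_subspace)
    show "bounded_linear ?P"
      by (intro bounded_linear_add bounded_linear_compose[OF T] bounded_linear_fst bounded_linear_snd)
    show "closed (V \<times> F)" using V F closed_Times by blast
    show "subspace (V \<times> F)" using V F subspace_Times by blast
    show "?P ` (V \<times> F) = W" using sum by force
  qed (rule W)
  then obtain K where K: "K > 0" "\<And>y. y \<in> W \<Longrightarrow> \<exists>p\<in>V \<times> F. ?P p = y \<and> norm p \<le> K * norm y"
    by blast
  have TVW: "T ` V \<subseteq> W" using sum subspace_0[OF F(2)] by force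
  show ?thesis unfolding closed_sequential_limits
  proof (intro allI impI, elim conjE)
    fix u y assume u: "\<forall>n. u n \<in> T ` V" "u \<longlonglongrightarrow> y"
    have "y \<in> W" by (rule closed_sequentially[OF W _ u(2)]) (use u(1) TVW in blast)
    then obtain v f where vf: "v \<in> V" "f \<in> F" "y = T v + f" using sum by blast
    have "norm f \<le> K * norm (y - u n)" for n
    proof -
      obtain w where w: "w \<in> V" "u n = T w" using u by blast
      have "y - u n = T (v - w) + f" by (simp add: vf w T.diff)
      moreover have "v - w \<in> V" using vf w V subspace_diff by blast
      ultimately have "y - u n \<in> W" using sum vf by blast
      then obtain p where p: "p \<in> V \<times> F" "?P p = y - u n" "norm p \<le> K * norm (y - u n)"
        using K by blast
      have "T (fst p - (v - w)) = f - snd p"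
        unfolding T.diff[of "fst p"] using p(2) \<open>y - u n = T (v - w) + f\<close>
        by (metis add.commute add_diff_cancel diff_diff_eq2 diff_eq_eq)
      moreover have "fst p - (v - w) \<in> V" using p \<open>v - w \<in> V\<close> V subspace_diff by auto
      moreover have "f - snd p \<in> F" using p vf F subspace_diff by auto
      ultimately have "f - snd p = 0" using int by (metis IntI image_eqI singletonD subsetD)
      then show ?thesis using norm_snd_le[of "snd p" "fst p"] p(3) by simp
    qed
    moreover have "(\<lambda>n. K * norm (y - u n)) \<longlonglongrightarrow> K * norm (y - y)"
      by (intro tendsto_intros u)
    ultimately have "norm f \<le> 0" by (intro LIMSEQ_le_const[where X = "\<lambda>n. K * norm (y - u n)"]) auto
    then show "y \<in> T ` V" using vf by auto
  qed
qed

section \<open>Elementary properties of bounded complex-linear operators\<close>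

lemma bounded_clinear_bounded_linear: "bounded_clinear T \<Longrightarrow> bounded_linear T"
  and bounded_clinear_scaleC: "bounded_clinear T \<Longrightarrow> T (c *\<^sub>C x) = c *\<^sub>C T x"
  by (simp_all add: bounded_clinear_def)

lemma bounded_clinear_zero: "bounded_clinear T \<Longrightarrow> T 0 = 0"
  and bounded_clinear_add: "bounded_clinear T \<Longrightarrow> T (x + y) = T x + T y"
  and bounded_clinear_diff: "bounded_clinear T \<Longrightarrow> T (x - y) = T x - T y"
  by (simp_all add: bounded_clinear_def linear_simps)

lemma bounded_clinear_shift_op:
  "bounded_clinear T \<Longrightarrow> bounded_clinear (shift_op T l)"
  unfolding bounded_clinear_def shift_op_def
  by (auto intro!: bounded_linear_sub bounded_linear_scaleC_right
      simp: complex_vector.scale_right_diff_distrib scaleC_scaleC mult.commute)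

lemma bounded_clinear_funpow:
  fixes T :: "'a::complex_normed_vector \<Rightarrow> 'a"
  shows "bounded_clinear T \<Longrightarrow> bounded_clinear (T ^^ n)"
proof (induction n)
  case 0
  show ?case by (simp add: bounded_clinear_def id_def bounded_linear_ident)
next
  case (Suc n)
  then show ?case
    by (auto simp: bounded_clinear_def o_def intro: bounded_linear_compose)
qed

lemma bounded_clinear_module_hom:
  "bounded_clinear T \<Longrightarrow> module_hom scaleC scaleC T"
  by unfold_locales
    (simp_all add: bounded_clinear_add bounded_clinear_scaleC scaleC_add_left scaleC_add_right scaleC_scaleC)

lemma complex_subspace_image:
  "bounded_clinear T \<Longrightarrow> complex_vector.subspace V \<Longrightarrow> complex_vector.subspace (T ` V)"
  by (rule module_hom.subspace_image[OF bounded_clinear_module_hom])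

lemma complex_span_image:
  "bounded_clinear T \<Longrightarrow> complex_vector.span (T ` V) = T ` complex_vector.span V"
  by (rule module_hom.span_image[OF bounded_clinear_module_hom])

lemma complex_subspace_kernel:
  assumes "bounded_clinear T" "complex_vector.subspace V"
  shows "complex_vector.subspace {x \<in> V. T x = 0}"
  using assms
  by (auto simp: complex_vector.subspace_def bounded_clinear_zero bounded_clinear_add bounded_clinear_scaleC)

lemma complex_subspace_range: "bounded_clinear T \<Longrightarrow> complex_vector.subspace (range T)"
  by (intro complex_subspace_image) (auto simp: complex_vector.subspace_UNIV)

lemma closed_kernel: "bounded_clinear T \<Longrightarrow> closed {x. T x = 0}"
  using continuous_closed_preimage_constant[of UNIV T 0]
  by (simp add: bounded_clinear_bounded_linear linear_continuous_on)

section \<open>Operators with the SVEP that are surjective on a subspace\<close>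

text \<open>Half the radius \<open>1 / K\<close> is used so that the differentiated series has,
  uniformly on the disc, a majorant with ratio 1/2; the series may then be differentiated term by
  term.\<close>

lemma vec_analytic_on_power_series:
  fixes x :: "nat \<Rightarrow> 'a::complex_banach"
  assumes "K > 0" and bound: "\<And>k. norm (x k) \<le> M * K ^ k" and r: "r = 1 / (2 * K)"
  shows "\<exists>f. vec_analytic_on f (ball l r) \<and> (\<forall>z\<in>ball l r. (\<lambda>k. (z - l) ^ k *\<^sub>C x k) sums f z)"
proof -
  define S where "S = ball l r"
  define d where "d z k = (of_nat k * (z - l) ^ (k - 1)) *\<^sub>C x k" for z k
  have M: "M \<ge> 0" using bound[of 0] by (metis mult.right_neutral norm_ge_zero order_trans power_0)
  have rK: "r * K = 1/2" and r0: "r > 0" using assms by auto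
  \<comment> \<open>From \<open>r * K = 1/2\<close> the \<open>k\<close>-th derivative term is at
    most \<open>k * (2 * K * M) * (1/2) ^ k\<close>. Enlarging \<open>k\<close> to
    \<open>Suc k\<close> gives the derivative of the geometric series, whose convergence is
    known.\<close>
  define a where "a k = (2 * K * M) * (of_nat (Suc k) * (1/2) ^ k)" for k
  have a: "summable a" unfolding a_def
    using geometric_deriv_sums[of "1/2::real"] by (intro summable_mult) (auto simp: sums_iff)
  have da: "norm (d z k) \<le> a k" if z: "z \<in> S" for z k
  proof (cases k)
    case 0
    then show ?thesis using M assms(1) by (simp add: d_def a_def)
  next
    case (Suc j)
    have "cmod (z - l) \<le> r" using z by (simp add: S_def dist_norm norm_minus_commute less_imp_le)
    then have "cmod (z - l) ^ j \<le> r ^ j" by (simp add: power_mono)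
    then have "cmod (z - l) ^ j * norm (x k) \<le> r ^ j * (M * K ^ Suc j)"
      using bound[of k] Suc r0 by (intro mult_mono) auto
    also have "\<dots> = (K * M) * (r * K) ^ j" by (simp add: power_mult_distrib)
    also have "\<dots> = (2 * K * M) * (1/2) ^ k" by (simp add: rK Suc)
    finally have 1: "cmod (z - l) ^ j * norm (x k) \<le> (2 * K * M) * (1/2) ^ k" .
    have "norm (d z k) = real k * (cmod (z - l) ^ j * norm (x k))"
      unfolding d_def norm_scaleC norm_mult norm_power norm_of_nat by (simp add: Suc)
    also have "\<dots> \<le> real (Suc k) * ((2 * K * M) * (1/2) ^ k)"
      by (rule mult_mono[OF _ 1]) simp_all
    finally show ?thesis by (simp add: a_def mult_ac)
  qed
  have dn: "summable (\<lambda>k. norm (d z k))" if "z \<in> S" for z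
    by (rule summable_comparison_test'[OF a, of 0]) (use da[OF that] in simp)
  have "\<exists>f. \<forall>z\<in>S. (\<lambda>k. (z - l) ^ k *\<^sub>C x k) sums f z \<and>
      (f has_derivative (\<lambda>h. h *\<^sub>C (\<Sum>k. d z k))) (at z within S)"
  proof (rule has_derivative_series[where f' = "\<lambda>k z h. h *\<^sub>C d z k"])
    show "convex S" by (simp add: S_def)
    show "l \<in> S" using r0 by (simp add: S_def)
    have "(\<lambda>k. (l - l) ^ k *\<^sub>C x k) sums (\<Sum>k\<in>{0}. (l - l) ^ k *\<^sub>C x k)"
      by (rule sums_finite) auto
    then show "(\<lambda>k. (l - l) ^ k *\<^sub>C x k) sums x 0" by (simp add: scaleC_one)
    fix k z
    have "((\<lambda>z. (z - l) ^ k) has_derivative (\<lambda>h. h * (of_nat k * (z - l) ^ (k - 1)))) (at z within S)"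
      by (auto intro!: derivative_eq_intros simp: mult_ac)
    from bounded_linear.has_derivative[OF bounded_linear_scaleC_left this]
    show "((\<lambda>z. (z - l) ^ k *\<^sub>C x k) has_derivative (\<lambda>h. h *\<^sub>C d z k)) (at z within S)"
      by (simp add: d_def scaleC_scaleC mult.assoc)
  next
    fix e :: real assume "e > 0"
    then obtain N where N: "\<And>n. n \<ge> N \<Longrightarrow> norm (\<Sum>i. a (i + n)) < e"
      using suminf_exist_split[OF _ a] by blast
    have "norm ((\<Sum>i<n. h *\<^sub>C d z i) - h *\<^sub>C (\<Sum>k. d z k)) \<le> e * norm h"
      if n: "n \<ge> N" and z: "z \<in> S" for n z h
    proof -
      have sd: "summable (d z)" by (rule summable_norm_cancel[OF dn[OF z]])
      have s: "summable (\<lambda>i. norm (d z (i + n)))"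
        using summable_ignore_initial_segment[OF dn[OF z]] .
      have "(\<Sum>k. d z k) - (\<Sum>i<n. d z i) = (\<Sum>i. d z (i + n))"
        using suminf_split_initial_segment[OF sd, of n] by simp
      then have "norm ((\<Sum>k. d z k) - (\<Sum>i<n. d z i)) \<le> (\<Sum>i. norm (d z (i + n)))"
        using summable_norm[OF s] by simp
      also have "\<dots> \<le> (\<Sum>i. a (i + n))"
        by (intro suminf_le da z s summable_ignore_initial_segment a)
      also have "\<dots> \<le> e" using N[OF n] by simp
      finally have 1: "norm ((\<Sum>k. d z k) - (\<Sum>i<n. d z i)) \<le> e" .
      have "norm ((\<Sum>i<n. h *\<^sub>C d z i) - h *\<^sub>C (\<Sum>k. d z k))
          = cmod h * norm ((\<Sum>k. d z k) - (\<Sum>i<n. d z i))"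
        by (simp add: complex_vector.scale_sum_right[symmetric] norm_minus_commute norm_scaleC
            complex_vector.scale_right_diff_distrib[symmetric])
      with mult_left_mono[OF 1 norm_ge_zero[of h]] show ?thesis by (simp only: mult.commute[of e])
    qed
    then show "\<forall>\<^sub>F n in sequentially. \<forall>z\<in>S. \<forall>h.
        norm ((\<Sum>i<n. h *\<^sub>C d z i) - h *\<^sub>C (\<Sum>k. d z k)) \<le> e * norm h"
      unfolding eventually_sequentially by blast
  qed
  then obtain f where f: "\<And>z. z \<in> S \<Longrightarrow> (\<lambda>k. (z - l) ^ k *\<^sub>C x k) sums f z"
    "\<And>z. z \<in> S \<Longrightarrow> (f has_derivative (\<lambda>h. h *\<^sub>C (\<Sum>k. d z k))) (at z within S)"
    by metis
  have "vec_analytic_on f S"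
    unfolding vec_analytic_on_def vec_holomorphic_on_def
  proof
    fix z assume "z \<in> S"
    then obtain e where "e > 0" "ball z e \<subseteq> S"
      by (metis S_def open_ball open_contains_ball)
    then show "\<exists>e>0. \<forall>w\<in>ball z e. \<exists>d. (f has_derivative (\<lambda>h. h *\<^sub>C d)) (at w within ball z e)"
      using f(2) by (meson has_derivative_subset subsetD)
  qed
  then show ?thesis using f(1) by (auto simp: S_def)
qed

text \<open>With \<open>S = T - l\<close>, \<open>u 0 = x\<close> and
  \<open>S (u (k + 1)) = u k\<close>, the sum \<open>f z\<close> of the terms
  \<open>(z - l) ^ k *\<^sub>C u k\<close> satisfies \<open>S (f z) = (z - l) *\<^sub>C f z\<close>,
  that is, \<open>(T - z) (f z) = 0\<close>. The SVEP gives \<open>f = 0\<close>, and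
  \<open>f l = x\<close>.\<close>

lemma svep_kernel_trivial:
  fixes T :: "'a::complex_banach \<Rightarrow> 'a"
  assumes T: "bounded_clinear T" and "svep T"
    and V: "closed V" "complex_vector.subspace V" "shift_op T l ` V = V"
    and x: "x \<in> V" "shift_op T l x = 0"
  shows "x = 0"
proof -
  let ?S = "shift_op T l"
  have S: "bounded_clinear ?S" using T by (rule bounded_clinear_shift_op)
  obtain K where K: "K > 0" "\<And>y. y \<in> V \<Longrightarrow> \<exists>x\<in>V. ?S x = y \<and> norm x \<le> K * norm y"
    using open_mapping_subspace[OF bounded_clinear_bounded_linear[OF S] V(1)
        subspace_if_complex_subspace[OF V(2)] V(1,3)] by blast
  then obtain g where g: "\<And>y. y \<in> V \<Longrightarrow> g y \<in> V \<and> ?S (g y) = y \<and> norm (g y) \<le> K * norm y"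
    by metis
  define u where "u k = (g ^^ k) x" for k
  have uV: "u k \<in> V" for k by (induction k) (use x g in \<open>auto simp: u_def\<close>)
  have Su: "?S (u (Suc k)) = u k" for k using g[OF uV[of k]] by (simp add: u_def)
  have un: "norm (u k) \<le> norm x * K ^ k" for k
  proof (induction k)
    case (Suc k)
    have "norm (u (Suc k)) \<le> K * norm (u k)" using g[OF uV[of k]] by (simp add: u_def)
    also have "\<dots> \<le> K * (norm x * K ^ k)" using Suc K by simp
    finally show ?case by (simp add: mult_ac)
  qed (simp add: u_def)
  define r where "r = 1 / (2 * K)"
  have r: "r > 0" using K by (simp add: r_def)
  obtain f where f: "vec_analytic_on f (ball l r)"
    "\<And>z. z \<in> ball l r \<Longrightarrow> (\<lambda>k. (z - l) ^ k *\<^sub>C u k) sums f z"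
    using vec_analytic_on_power_series[OF K(1) un r_def] by blast
  have "shift_op T z (f z) = 0" if z: "z \<in> ball l r" for z
  proof -
    have "(\<lambda>k. ?S ((z - l) ^ k *\<^sub>C u k)) sums ?S (f z)"
      by (rule bounded_linear.sums[OF bounded_clinear_bounded_linear[OF S] f(2)[OF z]])
    \<comment> \<open>Applying \<open>?S\<close> to term \<open>k + 1\<close> yields
      \<open>z - l\<close> times term \<open>k\<close>. Term 0 is sent to 0 because \<open>x\<close>
      is in the kernel, so dropping it does not change the sum.\<close>
    moreover have "(\<lambda>k. ?S ((z - l) ^ Suc k *\<^sub>C u (Suc k))) sums ((z - l) *\<^sub>C f z)"
      using bounded_linear.sums[OF bounded_linear_scaleC_right f(2)[OF z]]
      by (simp add: bounded_clinear_scaleC[OF S] Su scaleC_scaleC)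
    then have "(\<lambda>k. ?S ((z - l) ^ k *\<^sub>C u k)) sums ((z - l) *\<^sub>C f z)"
      using x(2) by (subst (asm) sums_Suc_iff) (simp add: u_def scaleC_one)
    ultimately have "?S (f z) = (z - l) *\<^sub>C f z" by (rule sums_unique2)
    then show ?thesis by (simp add: shift_op_def complex_vector.scale_left_diff_distrib)
  qed
  then have "f l = 0" using assms(2) f(1) r unfolding svep_def by (metis centre_in_ball)
  \<comment> \<open>At the centre only the term \<open>k = 0\<close> survives, as
    \<open>0 ^ 0 = 1\<close>.\<close>
  moreover have "(\<lambda>k. (l - l) ^ k *\<^sub>C u k) sums (\<Sum>k\<in>{0}. (l - l) ^ k *\<^sub>C u k)"
    by (rule sums_finite) auto
  ultimately show ?thesis
    using sums_unique2[OF f(2)[of l]] r by (auto simp: scaleC_one u_def)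
qed

section \<open>Codimension of the range\<close>

context vector_space begin

text \<open>Steinitz exchange modulo the span of \<open>R\<close>; keeping \<open>R\<close> inside
  every span replaces computation in a quotient space. When elements are added to \<open>B\<close>
  one by one, the element that first brings \<open>e\<close> into the span is the one that
  \<open>e\<close> can replace.\<close>

lemma exchange_mod_span:
  assumes "finite B" "e \<in> span (R \<union> B)" "e \<notin> span R"
  shows "\<exists>b\<in>B. span (R \<union> B) \<subseteq> span (insert e R \<union> (B - {b}))"
  using assms
proof (induction B)
  case (insert c B)
  show ?case
  proof (cases "e \<in> span (R \<union> B)")
    case True
    then obtain b where b: "b \<in> B" "span (R \<union> B) \<subseteq> span (insert e R \<union> (B - {b}))"
      using insert by blast
    let ?U = "span (insert e R \<union> (insert c B - {b}))"
    have "span (insert e R \<union> (B - {b})) \<subseteq> ?U" by (intro span_mono) auto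
    then have "R \<union> B \<subseteq> ?U" using b(2) span_superset by blast
    moreover have "c \<in> ?U" using b(1) insert(2) by (intro span_base) auto
    ultimately have "span (R \<union> insert c B) \<subseteq> ?U"
      by (intro span_minimal subspace_span) auto
    then show ?thesis using b(1) by auto
  next
    case False
    then have "c \<in> span (insert e (R \<union> B))"
      using in_span_insert[of e c "R \<union> B"] insert.prems by simp
    moreover have "insert e (R \<union> B) = insert e R \<union> (insert c B - {c})" using insert(2) by auto
    ultimately have "R \<union> insert c B \<subseteq> span (insert e R \<union> (insert c B - {c}))"
      by (auto intro: span_base)
    then show ?thesis by (intro bexI[of _ c] span_minimal subspace_span) auto
  qed
qed simp

text \<open>The exchange is iterated with \<open>R \<union> E\<close> in place of \<open>R\<close>,
  which protects the vectors already brought in from being removed again.\<close>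

lemma steinitz_mod_span:
  assumes "finite E" "finite B" "E \<subseteq> span (R \<union> B)"
    and "\<And>e. e \<in> E \<Longrightarrow> e \<notin> span (R \<union> (E - {e}))"
  shows "\<exists>B'\<subseteq>B. card B' + card E = card B \<and> span (R \<union> B) \<subseteq> span (R \<union> E \<union> B')"
  using assms
proof (induction E)
  case (insert e E)
  have "e' \<notin> span (R \<union> (E - {e'}))" if "e' \<in> E" for e'
  proof
    assume "e' \<in> span (R \<union> (E - {e'}))"
    moreover have "span (R \<union> (E - {e'})) \<subseteq> span (R \<union> (insert e E - {e'}))" by (intro span_mono) auto
    ultimately show False using insert.prems(3)[of e'] that by auto
  qed
  then obtain B' where B': "B' \<subseteq> B" "card B' + card E = card B" "span (R \<union> B) \<subseteq> span (R \<union> E \<union> B')"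
    using insert.IH insert.prems by auto
  have fB: "finite B'" using B'(1) insert.prems(1) finite_subset by blast
  have "e \<notin> span (R \<union> E)" using insert.prems(3)[of e] insert(2) by simp
  then obtain b where b: "b \<in> B'" "span (R \<union> E \<union> B') \<subseteq> span (insert e (R \<union> E) \<union> (B' - {b}))"
    using exchange_mod_span[OF fB, of e "R \<union> E"] B'(3) insert.prems(2) by auto
  have "span (R \<union> B) \<subseteq> span (R \<union> insert e E \<union> (B' - {b}))" using B'(3) b(2) by simp
  moreover have "card (B' - {b}) + card (insert e E) = card B"
    using B'(2) b(1) fB insert(1,2) card_gt_0_iff[of B'] by auto
  ultimately show ?case using B'(1) by (intro exI[of _ "B' - {b}"]) auto
qed auto

lemma subspace_eq_if_dim_le:
  assumes "subspace U" "U \<subseteq> W" "W \<subseteq> span F" "finite F" "dim W \<le> dim U"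
  shows "U = W"
proof -
  obtain E where E: "E \<subseteq> U" "independent E" "U \<subseteq> span E" "card E = dim U"
    using basis_exists by blast
  obtain D where D: "E \<subseteq> D" "D \<subseteq> W" "independent D" "W \<subseteq> span D"
    using maximal_independent_subset_extend[of E W] E(1,2) assms(2) by blast
  have "finite D" using independent_span_bound[OF assms(4) D(3)] D(2) assms(3) by blast
  moreover have "card D = dim W" using basis_card_eq_dim[OF D(2,4,3)] .
  ultimately have "E = D" using D(1) E(4) assms(5) by (intro card_seteq) auto
  then show ?thesis using D(4) E(1) assms(1,2) span_minimal by blast
qed

lemma decreasing_subspaces_stabilise:
  assumes "\<And>k. subspace (U k)" "decseq U" "U 0 \<subseteq> span F" "finite F"
  shows "\<exists>k0. \<forall>k\<ge>k0. U k = U k0"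
proof -
  \<comment> \<open>From an index of least dimension onwards, the decreasing subspaces have equal
    dimension and hence coincide.\<close>
  obtain k0 where k0: "\<And>k. dim (U k0) \<le> dim (U k)"
    using ex_has_least_nat[of "\<lambda>_. True" 0 "\<lambda>k. dim (U k)"] by auto
  have "U k = U k0" if "k \<ge> k0" for k
  proof (rule subspace_eq_if_dim_le[OF assms(1) _ _ assms(4) k0])
    show "U k \<subseteq> U k0" using assms(2) that by (rule decseqD)
    show "U k0 \<subseteq> span F" using decseqD[OF assms(2), of 0 k0] assms(3) by auto
  qed
  then show ?thesis by blast
qed

end

text \<open>The equality of dimensions \<open>dim (N / (N \<inter> TV)) = dim ((N + TV) / TV)\<close> transports a
  bound of the codimension of the range by the dimension of the kernel from \<open>V\<close> to
  \<open>T V\<close>. This is the part of the constancy of the index that is needed here.\<close>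

lemma codim_le_dim_kernel_image:
  assumes T: "bounded_clinear T" and V: "complex_vector.subspace V" "T ` V \<subseteq> V"
    and N: "finite_dim {x\<in>V. T x = 0}"
    and B: "finite B" "card B \<le> complex_vector.dim {x\<in>V. T x = 0}" "quot_spanning V (T ` V) B"
  shows "\<exists>B'. finite B' \<and> card B' \<le> complex_vector.dim {x\<in>T ` V. T x = 0} \<and>
    quot_spanning (T ` V) (T ` T ` V) B'"
proof -
  let ?N = "{x\<in>V. T x = 0}" and ?N' = "{x\<in>T ` V. T x = 0}"
  have R: "complex_vector.subspace (T ` V)" using T V(1) by (rule complex_subspace_image)
  have sN: "complex_vector.subspace ?N" using T V(1) by (rule complex_subspace_kernel)
  obtain F where F: "finite F" "complex_vector.span F = ?N" using N by (auto simp: finite_dim_def)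
  obtain E0 where E0: "E0 \<subseteq> ?N'" "complex_vector.independent E0" "?N' \<subseteq> complex_vector.span E0"
    "card E0 = complex_vector.dim ?N'"
    using complex_vector.basis_exists by blast
  have "E0 \<subseteq> ?N" using E0(1) V(2) by auto
  then obtain E1 where E1: "E0 \<subseteq> E1" "E1 \<subseteq> ?N" "complex_vector.independent E1"
    "?N \<subseteq> complex_vector.span E1"
    by (rule complex_vector.maximal_independent_subset_extend[OF _ E0(2)])
  have fE1: "finite E1"
    using complex_vector.independent_span_bound[OF F(1) E1(3)] E1(2) F(2) by blast
  have cE1: "card E1 = complex_vector.dim ?N"
    using complex_vector.basis_card_eq_dim[OF E1(2,4,3)] .
  \<comment> \<open>A basis \<open>E0\<close> of the kernel inside \<open>T\<close>
    V\<open>has been extended to a basis\<close>E1\<open>of the whole kernel; the new vectors\<close>E\<open>represent a basis of\<close>?N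
    / ?N'\<open>. They are independent modulo\<close>T \<open>V\<close>, so they can replace part of
    \<open>B\<close>.\<close>
  define E where "E = E1 - E0"
  have Vspan: "complex_vector.span (T ` V \<union> B) = V" "B \<subseteq> V" using B(3) by (auto simp: quot_spanning_def)
  have "\<exists>B'\<subseteq>B. card B' + card E = card B \<and>
    complex_vector.span (T ` V \<union> B) \<subseteq> complex_vector.span (T ` V \<union> E \<union> B')"
  proof (rule complex_vector.steinitz_mod_span)
    show "finite E" "finite B" "E \<subseteq> complex_vector.span (T ` V \<union> B)"
      using fE1 B(1) E1(2) Vspan by (auto simp: E_def)
    fix e assume e: "e \<in> E"
    show "e \<notin> complex_vector.span (T ` V \<union> (E - {e}))"
    proof
      assume "e \<in> complex_vector.span (T ` V \<union> (E - {e}))"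
      then obtain r s where rs: "e = r + s" "r \<in> complex_vector.span (T ` V)"
        "s \<in> complex_vector.span (E - {e})"
        unfolding complex_vector.span_Un by blast
      have rR: "r \<in> T ` V" using rs(2) R by (simp add: complex_vector.span_eq_iff[THEN iffD2])
      have "s \<in> ?N"
        using rs(3) complex_vector.span_minimal[OF _ sN, of "E - {e}"] E1(2) by (auto simp: E_def)
      moreover have "e \<in> ?N" using e E1(2) by (auto simp: E_def)
      ultimately have "e - s \<in> ?N" using complex_vector.subspace_diff[OF sN] by blast
      \<comment> \<open>A relation modulo the range is thus a relation modulo \<open>?N'\<close>,
        the span of \<open>E0\<close>, and contradicts the independence of
        \<open>E1\<close>.\<close>
      then have "r \<in> ?N'" using rR rs(1) by simp
      then have "r \<in> complex_vector.span (E1 - {e})"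
        using E0(3) complex_vector.span_mono[of E0 "E1 - {e}"] E1(1) e by (auto simp: E_def)
      moreover have "s \<in> complex_vector.span (E1 - {e})"
        using rs(3) complex_vector.span_mono[of "E - {e}" "E1 - {e}"] by (auto simp: E_def)
      ultimately have "e \<in> complex_vector.span (E1 - {e})"
        unfolding rs(1) by (rule complex_vector.span_add)
      moreover have "e \<in> E1" using e by (simp add: E_def)
      ultimately show False using E1(3) by (auto simp: complex_vector.dependent_def)
    qed
  qed
  then obtain B' where B': "B' \<subseteq> B" "card B' + card E = card B"
    "V \<subseteq> complex_vector.span (T ` V \<union> E \<union> B')" using Vspan by auto
  have "card E + card E0 = card E1"
    using E1(1) fE1 card_Diff_subset[of E0 E1] card_mono[of E1 E0] finite_subset[of E0 E1] by (simp add: E_def)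
  then have cB': "card B' \<le> card E0" using B(2) B'(2) cE1 by simp
  have fB': "finite B'" using B'(1) B(1) finite_subset by blast
  \<comment> \<open>Applying \<open>T\<close> annihilates \<open>E\<close>, so \<open>T\<close>
    B'\<open>alone spans\<close>T \<open>V\<close> modulo \<open>T\<close> T \<open>V\<close>.
    Removing \<open>card E\<close> vectors from \<open>B\<close> has lowered the bound from the
    dimension of \<open>?N\<close> to that of \<open>?N'\<close>.\<close>
  have "T ` V \<subseteq> complex_vector.span (T ` (T ` V \<union> E \<union> B'))"
    using B'(3) complex_span_image[OF T] by (metis image_mono)
  also have "\<dots> \<subseteq> complex_vector.span (T ` T ` V \<union> T ` B')"
  proof (intro complex_vector.span_minimal complex_vector.subspace_span)
    have "T e = 0" if "e \<in> E" for e using that E1(2) by (auto simp: E_def)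
    then show "T ` (T ` V \<union> E \<union> B') \<subseteq> complex_vector.span (T ` T ` V \<union> T ` B')"
      by (auto intro: complex_vector.span_base complex_vector.span_zero)
  qed
  finally have "T ` V \<subseteq> complex_vector.span (T ` T ` V \<union> T ` B')" .
  moreover have "complex_vector.span (T ` T ` V \<union> T ` B') \<subseteq> T ` V"
    using V(2) B'(1) Vspan(2) by (intro complex_vector.span_minimal R) auto
  moreover have "T ` B' \<subseteq> T ` V" using B'(1) Vspan(2) by auto
  ultimately have "quot_spanning (T ` V) (T ` T ` V) (T ` B')"
    unfolding quot_spanning_def by blast
  moreover have "card (T ` B') \<le> complex_vector.dim ?N'"
    using cB' card_image_le[OF fB', of T] E0(4) by simp
  ultimately show ?thesis using fB' by blast
qed

text \<open>A smallest finite set that together with the range spans \<open>V\<close> has as its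
  span a complement of the range. This complement is finite-dimensional, hence closed.\<close>

lemma closed_image_finite_codim:
  fixes T :: "'a::complex_banach \<Rightarrow> 'a"
  assumes T: "bounded_clinear T" and V: "closed V" "complex_vector.subspace V"
    and B: "finite B" "quot_spanning V (T ` V) B"
  shows "closed (T ` V)"
proof -
  have R: "complex_vector.subspace (T ` V)" using T V(2) by (rule complex_subspace_image)
  define P where "P B' \<longleftrightarrow> finite B' \<and> complex_vector.span (T ` V \<union> B') = V" for B'
  have "P B" using B by (auto simp: P_def quot_spanning_def)
  then obtain D where D: "P D" "\<And>D'. P D' \<Longrightarrow> card D \<le> card D'"
    using ex_has_least_nat[of P B card] by blast
  have fD: "finite D" and sD: "complex_vector.span (T ` V \<union> D) = V" using D(1) by (auto simp: P_def)
  show ?thesis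
  proof (rule closed_image_complemented[where F = "complex_vector.span D" and W = V])
    show "bounded_linear T" "closed V" "closed V" "subspace V"
      using T V by (auto intro: bounded_clinear_bounded_linear subspace_if_complex_subspace)
    show "closed (complex_vector.span D)" using fD by (rule closed_span_finite)
    show "subspace (complex_vector.span D)"
      by (intro subspace_if_complex_subspace complex_vector.subspace_span)
    have "V = {x + y |x y. x \<in> T ` V \<and> y \<in> complex_vector.span D}"
      using sD[unfolded complex_vector.span_Un complex_vector.span_eq_iff[THEN iffD2, OF R]] by (rule sym)
    then show "{T v + f |v f. v \<in> V \<and> f \<in> complex_vector.span D} = V" by blast
    show "T ` V \<inter> complex_vector.span D \<subseteq> {0}"
    proof (rule ccontr)
      assume "\<not> ?thesis"
      then obtain f where f: "f \<in> T ` V" "f \<in> complex_vector.span D" "f \<noteq> 0" by blast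
      \<comment> \<open>A nonzero \<open>f\<close> in the intersection could replace some
        \<open>b\<close> in \<open>D\<close>; since \<open>f\<close> is already in the range,
        \<open>D - {b}\<close> would still suffice, against minimality.\<close>
      then obtain b where b: "b \<in> D" "complex_vector.span D \<subseteq> complex_vector.span (insert f (D - {b}))"
        using complex_vector.exchange_mod_span[OF fD, of f "{}"] by auto
      have "complex_vector.span (insert f (D - {b})) \<subseteq> complex_vector.span (T ` V \<union> (D - {b}))"
        using f(1) by (intro complex_vector.span_mono) auto
      then have "D \<subseteq> complex_vector.span (T ` V \<union> (D - {b}))"
        using b(2) complex_vector.span_superset by blast
      then have "complex_vector.span (T ` V \<union> D) \<subseteq> complex_vector.span (T ` V \<union> (D - {b}))"
        by (intro complex_vector.span_minimal complex_vector.subspace_span) (auto intro: complex_vector.span_base)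
      moreover have "complex_vector.span (T ` V \<union> (D - {b})) \<subseteq> complex_vector.span (T ` V \<union> D)"
        by (intro complex_vector.span_mono) auto
      ultimately have "P (D - {b})" using fD sD by (auto simp: P_def)
      from D(2)[OF this] show False using b(1) fD by (meson card_Diff1_less not_le)
    qed
  qed
qed

section \<open>Finite ascent and descent\<close>

text \<open>Only the inclusions that can fail are demanded: the reverse one always holds for ranges,
  and for kernels whenever \<open>T 0 = 0\<close>. In that case both conditions persist for larger
  exponents, so a common \<open>n\<close> loses no generality.\<close>

definition finite_ascent_descent :: "('a::zero \<Rightarrow> 'a) \<Rightarrow> bool"
  where "finite_ascent_descent T \<longleftrightarrow>
    (\<exists>n. (\<forall>x. (T ^^ Suc n) x = 0 \<longrightarrow> (T ^^ n) x = 0) \<and> range (T ^^ n) \<subseteq> range (T ^^ Suc n))"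

lemma ascent_mono:
  fixes T :: "'a::zero \<Rightarrow> 'a"
  assumes "\<And>x. (T ^^ Suc n) x = 0 \<Longrightarrow> (T ^^ n) x = 0" and "(T ^^ (k + n)) x = 0"
  shows "(T ^^ n) x = 0"
  using assms(2)
proof (induction k arbitrary: x)
  case (Suc k)
  have "(T ^^ (k + n)) (T x) = 0" using Suc.prems by (simp add: funpow_swap1)
  then have "(T ^^ n) (T x) = 0" by (rule Suc.IH)
  then show ?case using assms(1)[of x] by (simp add: funpow_swap1)
qed simp

lemma descent_mono:
  fixes T :: "'a \<Rightarrow> 'a"
  assumes "range (T ^^ n) \<subseteq> range (T ^^ Suc n)"
  shows "range (T ^^ n) \<subseteq> range (T ^^ (k + n))"
proof (induction k)
  case (Suc k)
  have "range (T ^^ Suc n) = T ` range (T ^^ n)" by (auto simp: image_image)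
  also have "\<dots> \<subseteq> T ` range (T ^^ (k + n))" using Suc by (rule image_mono)
  also have "\<dots> = range (T ^^ (Suc k + n))" by (auto simp: image_image)
  finally show ?case using assms by auto
qed simp

lemma range_funpow_Suc:
  fixes T :: "'a \<Rightarrow> 'a"
  shows "T ` range (T ^^ n) = range (T ^^ Suc n)"
  by (auto simp: image_image)

lemma range_funpow_Suc_subset:
  fixes T :: "'a \<Rightarrow> 'a"
  shows "range (T ^^ Suc n) \<subseteq> range (T ^^ n)"
  by (auto simp: funpow_swap1)

lemma bij_finite_ascent_descent:
  assumes "bij T" "T 0 = 0"
  shows "finite_ascent_descent T"
  unfolding finite_ascent_descent_def
  using assms by (intro exI[of _ 0]) (auto simp: bij_def inj_def)

section \<open>Finite ascent and descent compared with the B-Weyl property\<close>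

theorem svep_b_weyl_finite_ascent_descent:
  fixes T :: "'a::complex_banach \<Rightarrow> 'a"
  assumes T: "bounded_clinear T" and "svep T" and "b_weyl (shift_op T l)"
  shows "finite_ascent_descent (shift_op T l)"
proof -
  let ?S = "shift_op T l"
  have S: "bounded_clinear ?S" using T by (rule bounded_clinear_shift_op)
  obtain n where cl: "closed (range (?S ^^ n))" and fr: "fredholm_on (range (?S ^^ n)) ?S"
    and ind: "index_on (range (?S ^^ n)) ?S = 0"
    using assms(3) by (auto simp: b_weyl_def b_fredholm_index_def)
  define V where "V k = range (?S ^^ (k + n))" for k
  define N where "N k = {x \<in> V k. ?S x = 0}" for k
  have SV: "?S ` V k = V (Suc k)" for k by (simp only: V_def range_funpow_Suc add_Suc)
  have VS: "V (Suc k) \<subseteq> V k" for k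
    unfolding V_def add_Suc by (rule range_funpow_Suc_subset)
  have sV: "complex_vector.subspace (V k)" for k
    unfolding V_def by (intro complex_subspace_range bounded_clinear_funpow S)
  have dV: "decseq V" using VS by (rule decseq_SucI)
  have sN: "complex_vector.subspace (N k)" for k
    unfolding N_def by (intro complex_subspace_kernel S sV)
  have dN: "decseq N" using dV by (auto simp: N_def decseq_def)
  obtain F where F: "finite F" "complex_vector.span F = N 0"
    using fr by (auto simp: fredholm_on_def finite_dim_def N_def V_def)
  have fN: "finite_dim (N k)" for k
  proof -
    have *: "N k \<subseteq> complex_vector.span F" using F(2) decseqD[OF dN, of 0 k] by simp
    obtain E where E: "E \<subseteq> N k" "complex_vector.independent E" "N k \<subseteq> complex_vector.span E"
      by (rule complex_vector.maximal_independent_subset)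
    have "finite E" using complex_vector.independent_span_bound[OF F(1) E(2)] E(1) * by blast
    moreover have "complex_vector.span E = N k"
      using E(1,3) complex_vector.span_minimal[OF E(1) sN] by blast
    ultimately show ?thesis by (auto simp: finite_dim_def)
  qed
  \<comment> \<open>At \<open>k = 0\<close> the codimension equals the dimension of the kernel
    because the index is 0. Passing to \<open>V (Suc k)\<close> preserves the inequality by
    \<open>codim_le_dim_kernel_image\<close> and closedness by the finite codimension. The
    inequality is all that is needed once a kernel vanishes.\<close>
  have inv: "closed (V k) \<and> (\<exists>B. finite B \<and> card B \<le> complex_vector.dim (N k) \<and> quot_spanning (V k) (V (Suc k)) B)" for k
  proof (induction k)
    case 0
    have "\<exists>m B. finite B \<and> card B = m \<and> quot_spanning (V 0) (?S ` V 0) B"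
      using fr by (auto simp: fredholm_on_def quot_finite_dim_def V_def)
    then have "\<exists>B. finite B \<and> card B = quot_dim (V 0) (?S ` V 0) \<and> quot_spanning (V 0) (?S ` V 0) B"
      unfolding quot_dim_def by (rule LeastI_ex)
    moreover have "quot_dim (V 0) (?S ` V 0) = complex_vector.dim (N 0)"
      using ind by (simp add: index_on_def V_def N_def)
    ultimately show ?case using cl SV[of 0] by (auto simp: V_def)
  next
    case (Suc k)
    then obtain B where B: "finite B" "card B \<le> complex_vector.dim (N k)" "quot_spanning (V k) (?S ` V k) B"
      by (auto simp: SV)
    have "closed (?S ` V k)" using S _ sV B(1,3) by (rule closed_image_finite_codim) (use Suc in blast)
    moreover have "\<exists>B'. finite B' \<and> card B' \<le> complex_vector.dim {x \<in> ?S ` V k. ?S x = 0} \<and>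
        quot_spanning (?S ` V k) (?S ` ?S ` V k) B'"
      using S sV _ _ B(1) _ B(3)
      by (rule codim_le_dim_kernel_image) (use SV VS fN[of k] B(2) in \<open>simp_all add: N_def\<close>)
    ultimately show ?case by (simp add: SV N_def)
  qed
  obtain k0 where k0: "\<And>k. k \<ge> k0 \<Longrightarrow> N k = N k0"
    using complex_vector.decreasing_subspaces_stabilise[OF sN dN _ F(1)] F(2) by blast
  define W where "W = (\<Inter>k. V k)"
  have "?S ` W = W"
  proof
    show "?S ` W \<subseteq> W" using SV VS by (fastforce simp: W_def)
    show "W \<subseteq> ?S ` W"
    proof
      fix y assume y: "y \<in> W"
      have "\<exists>x\<in>V k. ?S x = y" for k
      proof -
        have "y \<in> ?S ` V k" using y unfolding SV W_def by blast
        then show ?thesis by blast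
      qed
      then obtain x where x: "\<And>k. x k \<in> V k" "\<And>k. ?S (x k) = y" by metis
      \<comment> \<open>One preimage must work for all \<open>k\<close>. For \<open>k > k0\<close>,
        \<open>x k0\<close> and \<open>x k\<close> differ by an element of
        \<open>N k0 = N k\<close>, which lies in \<open>V k\<close>.\<close>
      have "x k0 \<in> V k" for k
      proof (cases "k \<le> k0")
        case True
        then show ?thesis using x(1)[of k0] decseqD[OF dV] by blast
      next
        case False
        then have "x k \<in> V k0" using x(1)[of k] decseqD[OF dV, of k0 k] by auto
        then have "x k0 - x k \<in> N k0"
          using x complex_vector.subspace_diff[OF sV] by (simp add: N_def bounded_clinear_diff[OF S])
        then have "x k0 - x k \<in> V k" using k0[of k] False by (auto simp: N_def)
        from complex_vector.subspace_add[OF sV this x(1)] show ?thesis by simp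
      qed
      then have "x k0 \<in> W" by (simp add: W_def)
      then show "y \<in> ?S ` W" using x(2)[of k0] by blast
    qed
  qed
  moreover have "closed W" using inv unfolding W_def by (intro closed_INT) blast
  moreover have "complex_vector.subspace W"
    unfolding W_def using sV by (auto simp: complex_vector.subspace_def)
  ultimately have triv: "x = 0" if "x \<in> W" "?S x = 0" for x
    using svep_kernel_trivial[OF T assms(2)] that by blast
  \<comment> \<open>Stabilisation puts \<open>N k0\<close> inside every \<open>V k\<close>, hence
    inside \<open>W\<close>, where \<open>?S\<close> is onto and the SVEP applies.\<close>
  have N0: "N k0 = {0}"
  proof
    have "x = 0" if x: "x \<in> N k0" for x
    proof (rule triv)
      have "x \<in> V k" for k
      proof (cases "k0 \<le> k")
        case True
        then show ?thesis using k0[of k] x by (auto simp: N_def)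
      next
        case False
        then show ?thesis using x decseqD[OF dV, of k k0] by (auto simp: N_def)
      qed
      then show "x \<in> W" by (simp add: W_def)
      show "?S x = 0" using x by (simp add: N_def)
    qed
    then show "N k0 \<subseteq> {0}" by blast
    show "{0} \<subseteq> N k0" using complex_vector.subspace_0[OF sN] by blast
  qed
  then have "complex_vector.dim (N k0) = 0"
    using complex_vector.dim_le_card[of "{0}" "{}"] by simp
  then obtain B where "finite B" "card B = 0" "quot_spanning (V k0) (V (Suc k0)) B"
    using inv[of k0] by auto
  then have "V k0 = V (Suc k0)"
    using sV[of "Suc k0"] by (auto simp: quot_spanning_def complex_vector.span_eq_iff[THEN iffD2])
  moreover have "(?S ^^ (k0 + n)) x = 0" if "(?S ^^ Suc (k0 + n)) x = 0" for x
  proof -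
    have "(?S ^^ (k0 + n)) x \<in> N k0" using that by (simp add: N_def V_def)
    then show ?thesis using N0 by blast
  qed
  ultimately show ?thesis unfolding finite_ascent_descent_def V_def add_Suc by blast
qed

text \<open>The space is the direct sum of the range and the kernel of \<open>T ^^ n\<close>:
  descent allows solving \<open>(T ^^ n) y = (T ^^ (n + n)) z\<close>, and ascent makes the
  intersection zero. The kernel is closed, so the complemented range is closed too, and
  \<open>T\<close> is bijective on it.\<close>

lemma finite_ascent_descentE:
  fixes T :: "'a::complex_banach \<Rightarrow> 'a"
  assumes T: "bounded_clinear T" and "finite_ascent_descent T"
  obtains n where "closed (range (T ^^ n))" "T ` range (T ^^ n) = range (T ^^ n)"
    "\<And>x. x \<in> range (T ^^ n) \<Longrightarrow> T x = 0 \<Longrightarrow> x = 0"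
    "\<And>y. \<exists>z u. y = (T ^^ n) z + u \<and> (T ^^ n) u = 0"
proof -
  obtain n where n: "\<And>x. (T ^^ Suc n) x = 0 \<Longrightarrow> (T ^^ n) x = 0" "range (T ^^ n) \<subseteq> range (T ^^ Suc n)"
    using assms(2) by (auto simp: finite_ascent_descent_def)
  have P: "bounded_clinear (T ^^ n)" using T by (rule bounded_clinear_funpow)
  have dec: "\<exists>z u. y = (T ^^ n) z + u \<and> (T ^^ n) u = 0" for y
  proof -
    have "(T ^^ n) y \<in> range (T ^^ (n + n))" using descent_mono[OF n(2), of n] by blast
    then obtain z where "(T ^^ n) y = (T ^^ n) ((T ^^ n) z)" by (auto simp: funpow_add)
    then have "(T ^^ n) (y - (T ^^ n) z) = 0" by (simp add: bounded_clinear_diff[OF P])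
    then show ?thesis by (intro exI[of _ z] exI[of _ "y - (T ^^ n) z"]) simp
  qed
  show thesis
  proof
    show "T ` range (T ^^ n) = range (T ^^ n)"
      using n(2) range_funpow_Suc_subset[where T = T and n = n] unfolding range_funpow_Suc by blast
    show "x = 0" if x: "x \<in> range (T ^^ n)" "T x = 0" for x
    proof -
      obtain z where "x = (T ^^ n) z" using x(1) by blast
      then show ?thesis using n(1)[of z] x(2) by simp
    qed
    show "closed (range (T ^^ n))"
    proof (rule closed_image_complemented[where F = "{u. (T ^^ n) u = 0}" and W = UNIV])
      show "bounded_linear (T ^^ n)" using P by (rule bounded_clinear_bounded_linear)
      show "closed {u. (T ^^ n) u = 0}" using P by (rule closed_kernel)
      show "subspace {u. (T ^^ n) u = 0}"
        using subspace_if_complex_subspace[OF complex_subspace_kernel[OF P complex_vector.subspace_UNIV]] by simp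
      show "{(T ^^ n) v + f |v f. v \<in> UNIV \<and> f \<in> {u. (T ^^ n) u = 0}} = UNIV"
        using dec by blast
      have "(T ^^ n) v = 0" if "(T ^^ n) ((T ^^ n) v) = 0" for v
        using ascent_mono[where T = T and n = n and k = n and x = v] n(1) that by (simp add: funpow_add)
      then show "range (T ^^ n) \<inter> {u. (T ^^ n) u = 0} \<subseteq> {0}" by auto
    qed (simp_all add: subspace_UNIV)
  qed (rule dec)
qed

text \<open>On the closed range of a suitable power \<open>T\<close> is bijective, so kernel and
  cokernel both have dimension 0.\<close>

theorem finite_ascent_descent_b_weyl:
  fixes T :: "'a::complex_banach \<Rightarrow> 'a"
  assumes T: "bounded_clinear T" and "finite_ascent_descent T"
  shows "b_weyl T"
proof -
  obtain n where n: "closed (range (T ^^ n))" "T ` range (T ^^ n) = range (T ^^ n)"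
    "\<And>x. x \<in> range (T ^^ n) \<Longrightarrow> T x = 0 \<Longrightarrow> x = 0"
    using finite_ascent_descentE[OF assms] by metis
  let ?R = "range (T ^^ n)"
  have R: "complex_vector.subspace ?R"
    by (intro complex_subspace_range bounded_clinear_funpow T)
  have ker: "{x \<in> ?R. T x = 0} = {0}"
    using n(3) complex_vector.subspace_0[OF R] bounded_clinear_zero[OF T] by auto
  have q: "quot_spanning ?R ?R {}"
    using R by (simp add: quot_spanning_def complex_vector.span_eq_iff[THEN iffD2])
  have "finite_dim {0::'a}"
    unfolding finite_dim_def by (intro exI[of _ "{}"]) simp
  then have "fredholm_on ?R T"
    unfolding fredholm_on_def ker n(2) quot_finite_dim_def using q by blast
  moreover have "quot_dim ?R ?R = 0"
    unfolding quot_dim_def using q by (intro Least_eq_0) auto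
  then have "index_on ?R T = 0"
    unfolding index_on_def ker n(2) using complex_vector.dim_le_card[of "{0::'a}" "{}"] by simp
  ultimately show ?thesis
    unfolding b_weyl_def b_fredholm_def b_fredholm_index_def using n(1) by blast
qed

section \<open>The spectrum and its isolated points\<close>

lemma not_in_spectrum_iff_bij:
  fixes T :: "'a::complex_banach \<Rightarrow> 'a"
  assumes T: "bounded_clinear T"
  shows "l \<notin> spectrum T \<longleftrightarrow> bij (shift_op T l)"
proof
  assume "l \<notin> spectrum T"
  then show "bij (shift_op T l)" unfolding spectrum_def using o_bij by blast
next
  let ?S = "shift_op T l"
  have S: "bounded_clinear ?S" using T by (rule bounded_clinear_shift_op)
  assume bij: "bij ?S"
  \<comment> \<open>Injectivity identifies this controlled preimage with \<open>inv ?S y\<close>, so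
    the open mapping bound makes the inverse bounded.\<close>
  obtain K where K: "\<And>y. \<exists>x. ?S x = y \<and> norm x \<le> K * norm y"
    using open_mapping_subspace[OF bounded_clinear_bounded_linear[OF S], of UNIV UNIV] bij
    by (auto simp: bij_def)
  have inj: "inj ?S" and Sinv: "?S (inv ?S y) = y" for y
    using bij by (auto simp: bij_def surj_f_inv_f)
  have "bounded_clinear (inv ?S)"
    unfolding bounded_clinear_def
  proof (intro conjI allI)
    show "inv ?S (c *\<^sub>C x) = c *\<^sub>C inv ?S x" for c x
      by (rule injD[OF inj]) (simp add: Sinv bounded_clinear_scaleC[OF S])
    show "bounded_linear (inv ?S)"
    proof (rule bounded_linear_intro[where K = K])
      show "inv ?S (x + y) = inv ?S x + inv ?S y" for x y
        by (rule injD[OF inj]) (simp add: Sinv bounded_clinear_add[OF S])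
      show "inv ?S (r *\<^sub>R x) = r *\<^sub>R inv ?S x" for r x
        by (rule injD[OF inj]) (simp add: Sinv bounded_clinear_scaleC[OF S] scaleR_scaleC)
      show "norm (inv ?S y) \<le> norm y * K" for y
        using K[of y] inv_f_f[OF inj] by (metis mult.commute)
    qed
  qed
  moreover have "inv ?S \<circ> ?S = id" "?S \<circ> inv ?S = id"
    using inj bij by (auto simp: bij_def surj_iff)
  ultimately show "l \<notin> spectrum T" by (auto simp: spectrum_def)
qed

text \<open>On the range \<open>R\<close> of \<open>T ^^ n\<close> the operator is invertible with
  inverse bounded by \<open>K\<close>, which tolerates subtracting \<open>m\<close> if
  \<open>cmod m < 1 / K\<close>. On the kernel of \<open>T ^^ n\<close> it is nilpotent, so
  subtracting any \<open>m \<noteq> 0\<close> gives an invertible operator.\<close>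

lemma finite_ascent_descent_bij_near:
  fixes T :: "'a::complex_banach \<Rightarrow> 'a"
  assumes T: "bounded_clinear T" and "finite_ascent_descent T"
  shows "\<exists>c>0. \<forall>m. m \<noteq> 0 \<longrightarrow> cmod m < c \<longrightarrow> bij (shift_op T m)"
proof -
  obtain n where n: "closed (range (T ^^ n))" "T ` range (T ^^ n) = range (T ^^ n)"
    "\<And>x. x \<in> range (T ^^ n) \<Longrightarrow> T x = 0 \<Longrightarrow> x = 0"
    "\<And>y. \<exists>z u. y = (T ^^ n) z + u \<and> (T ^^ n) u = 0"
    using finite_ascent_descentE[OF assms] by metis
  define R where "R = range (T ^^ n)"
  have P: "bounded_clinear (T ^^ n)" using T by (rule bounded_clinear_funpow)
  have R: "complex_vector.subspace R"
    unfolding R_def by (intro complex_subspace_range P)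
  obtain K where K: "K > 0" "\<And>y. y \<in> R \<Longrightarrow> \<exists>x\<in>R. T x = y \<and> norm x \<le> K * norm y"
    using open_mapping_subspace[OF bounded_clinear_bounded_linear[OF T] n(1)
        subspace_if_complex_subspace[OF R[unfolded R_def]] n(1,2)]
    unfolding R_def by blast
  have inj: "x = y" if "x \<in> R" "y \<in> R" "T x = T y" for x y
    using n(3)[of "x - y"] that complex_vector.subspace_diff[OF R]
    by (simp add: R_def bounded_clinear_diff[OF T])
  have le: "norm x \<le> K * norm (T x)" if "x \<in> R" for x
  proof -
    have "T x \<in> R" using n(2) that unfolding R_def by blast
    then show ?thesis using K(2)[of "T x"] inj that by metis
  qed
  obtain g where g: "\<And>y. y \<in> R \<Longrightarrow> g y \<in> R \<and> T (g y) = y" using K(2) by metis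
  have "bij (shift_op T m)" if m: "m \<noteq> 0" "cmod m < 1 / K" for m
  proof -
    let ?S = "shift_op T m"
    have S: "bounded_clinear ?S" using T by (rule bounded_clinear_shift_op)
    have mK: "K * cmod m < 1" using m(2) K(1) by (simp add: field_simps)
    have "x = 0" if x: "?S x = 0" for x
    proof -
      have Tx: "T x = m *\<^sub>C x" using x by (simp add: shift_op_def)
      have Tk: "(T ^^ k) x = m ^ k *\<^sub>C x" for k
        by (induction k) (simp_all add: scaleC_one bounded_clinear_scaleC[OF T] Tx scaleC_scaleC mult.commute)
      \<comment> \<open>Because \<open>m \<noteq> 0\<close>, an eigenvector lies in
        \<open>R\<close>, where \<open>le\<close> applies.\<close>
      have "x = (T ^^ n) (inverse (m ^ n) *\<^sub>C x)"
        using m(1) by (simp add: bounded_clinear_scaleC[OF P] Tk scaleC_scaleC scaleC_one)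
      then have "x \<in> R" unfolding R_def by blast
      from le[OF this] have "norm x \<le> (K * cmod m) * norm x" by (simp add: Tx norm_scaleC)
      then have "norm x * (1 - K * cmod m) \<le> 0" by (simp add: algebra_simps)
      then show "x = 0" using mK by (simp add: mult_le_0_iff)
    qed
    then have "inj ?S"
      by (intro injI) (metis bounded_clinear_diff[OF S] eq_iff_diff_eq_0)
    moreover have rS: "complex_vector.subspace (range ?S)" using S by (rule complex_subspace_range)
    \<comment> \<open>Induction on the order of nilpotency, based on
      \<open>u = (1 / m) *\<^sub>C (T u - ?S u)\<close>, where \<open>T u\<close> is covered by the
      induction hypothesis.\<close>
    have nil: "u \<in> range ?S" if "(T ^^ k) u = 0" for k u
      using that
    proof (induction k arbitrary: u)
      case 0
      then show ?case using complex_vector.subspace_0[OF rS] by simp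
    next
      case (Suc k)
      then have "T u \<in> range ?S" by (simp add: funpow_swap1)
      then have "T u - ?S u \<in> range ?S" using complex_vector.subspace_diff[OF rS] by blast
      then have "(1 / m) *\<^sub>C (T u - ?S u) \<in> range ?S" by (rule complex_vector.subspace_scale[OF rS])
      then show ?case using m(1) by (simp add: shift_op_def scaleC_scaleC scaleC_one)
    qed
    have "v \<in> range ?S" if v: "v \<in> R" for v
    proof -
      have vR: "v + m *\<^sub>C w \<in> R" if "w \<in> R" for w
        using v that R by (intro complex_vector.subspace_add complex_vector.subspace_scale)
      \<comment> \<open>Solving \<open>T w - m *\<^sub>C w = v\<close> in \<open>R\<close> is a
        fixed point problem for the inverse \<open>g\<close> of \<open>T\<close> on
        \<open>R\<close>, with contraction constant \<open>K * cmod m\<close>.\<close>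
      have "\<exists>!w\<in>R. g (v + m *\<^sub>C w) = w"
      proof (rule Banach_fix[where c = "K * cmod m"])
        show "complete R" using n(1) by (simp add: R_def complete_eq_closed)
        show "R \<noteq> {}" "0 \<le> K * cmod m" "K * cmod m < 1" using v K mK by auto
        show "(\<lambda>w. g (v + m *\<^sub>C w)) ` R \<subseteq> R" using g vR by blast
        fix x y assume xy: "x \<in> R" "y \<in> R"
        let ?x = "g (v + m *\<^sub>C x)" and ?y = "g (v + m *\<^sub>C y)"
        have "?x - ?y \<in> R" using g vR xy complex_vector.subspace_diff[OF R] by blast
        then have "norm (?x - ?y) \<le> K * norm (T (?x - ?y))" by (rule le)
        also have "T (?x - ?y) = m *\<^sub>C (x - y)"
          using g vR xy by (simp add: bounded_clinear_diff[OF T] complex_vector.scale_right_diff_distrib)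
        finally show "dist ?x ?y \<le> K * cmod m * dist x y"
          by (simp add: dist_norm norm_scaleC mult.assoc)
      qed
      then obtain w where "w \<in> R" "g (v + m *\<^sub>C w) = w" by blast
      then have "T w = v + m *\<^sub>C w" using g vR by metis
      then have "v = ?S w" by (simp add: shift_op_def)
      then show ?thesis by blast
    qed
    then have "y \<in> range ?S" for y
      using n(4)[of y] nil complex_vector.subspace_add[OF rS] unfolding R_def by blast
    ultimately show ?thesis by (auto simp: bij_def)
  qed
  then show ?thesis using K(1) by (intro exI[of _ "1 / K"]) auto
qed

lemma shift_op_shift_op: "shift_op (shift_op T l) m = shift_op T (l + m)"
  by (simp add: shift_op_def complex_vector.scale_left_distrib diff_diff_eq)

text \<open>Bijectivity at nearby points isolates \<open>l\<close>. If \<open>l\<close> were no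
  eigenvalue, \<open>?S\<close> would be injective, and cancelling \<open>?S ^^ n\<close> in the
  descent condition would make it surjective as well, so \<open>l\<close> would not be in the
  spectrum.\<close>

theorem finite_ascent_descent_isolated_eigenvalue:
  fixes T :: "'a::complex_banach \<Rightarrow> 'a"
  assumes T: "bounded_clinear T" and fin: "finite_ascent_descent (shift_op T l)"
    and l: "l \<in> spectrum T"
  shows "l \<in> isolated_eigenvalues T"
proof -
  let ?S = "shift_op T l"
  have S: "bounded_clinear ?S" using T by (rule bounded_clinear_shift_op)
  obtain c where c: "c > 0" "\<And>m. m \<noteq> 0 \<Longrightarrow> cmod m < c \<Longrightarrow> bij (shift_op ?S m)"
    using finite_ascent_descent_bij_near[OF S fin] by blast
  have "m = l" if "m \<in> spectrum T" "dist l m < c" for m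
    using c(2)[of "m - l"] not_in_spectrum_iff_bij[OF T, of m] that
    by (auto simp: shift_op_shift_op dist_norm norm_minus_commute)
  then have iso: "l isolated_in spectrum T"
    using l c(1) unfolding isolated_in_dist_Ex_iff by blast
  have "\<not> bij ?S" using l not_in_spectrum_iff_bij[OF T] by blast
  have "eigenvalue T l"
  proof (rule ccontr)
    assume "\<not> eigenvalue T l"
    then have ker: "x = 0" if "?S x = 0" for x
      using that by (auto simp: eigenvalue_def shift_op_def)
    then have inj: "inj ?S"
      by (intro injI) (metis bounded_clinear_diff[OF S] eq_iff_diff_eq_0)
    obtain n where n: "range (?S ^^ n) \<subseteq> range (?S ^^ Suc n)"
      using fin by (auto simp: finite_ascent_descent_def)
    have "y \<in> range ?S" for y
    proof -
      obtain z where "(?S ^^ n) y = (?S ^^ Suc n) z" using n by blast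
      then have "(?S ^^ n) y = (?S ^^ n) (?S z)" by (simp add: funpow_swap1)
      then show ?thesis using inj_fn[OF inj, of n] by (auto dest: injD)
    qed
    then show False using inj \<open>\<not> bij ?S\<close> by (auto simp: bij_def)
  qed
  then show ?thesis using iso by (simp add: isolated_eigenvalues_def)
qed

corollary svep_b_weyl_isolated_eigenvalue:
  fixes T :: "'a::complex_banach \<Rightarrow> 'a"
  assumes "bounded_clinear T" "svep T"
  shows "spectrum T - b_weyl_spectrum T \<subseteq> isolated_eigenvalues T"
  using svep_b_weyl_finite_ascent_descent[OF assms] finite_ascent_descent_isolated_eigenvalue[OF assms(1)]
  by (auto simp: b_weyl_spectrum_def)

lemma b_weyl_spectrum_subset_spectrum:
  fixes T :: "'a::complex_banach \<Rightarrow> 'a"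
  assumes T: "bounded_clinear T"
  shows "b_weyl_spectrum T \<subseteq> spectrum T"
proof
  fix l assume l: "l \<in> b_weyl_spectrum T"
  show "l \<in> spectrum T"
  proof (rule ccontr)
    assume "l \<notin> spectrum T"
    then have "bij (shift_op T l)" using not_in_spectrum_iff_bij[OF T] by blast
    then have "finite_ascent_descent (shift_op T l)"
      using bounded_clinear_zero[OF bounded_clinear_shift_op[OF T]]
      by (rule bij_finite_ascent_descent)
    then show False
      using l finite_ascent_descent_b_weyl[OF bounded_clinear_shift_op[OF T]]
      by (auto simp: b_weyl_spectrum_def)
  qed
qed

section \<open>Upper triangular operators\<close>

lemma bounded_clinear_upper_triangular_op:
  assumes "bounded_clinear A" "bounded_clinear B" "bounded_clinear C"
  shows "bounded_clinear (upper_triangular_op A C B)"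
proof -
  have "bounded_linear (\<lambda>p. (A (fst p) + C (snd p), B (snd p)))"
    using assms[THEN bounded_clinear_bounded_linear]
    by (intro bounded_linear_Pair bounded_linear_add) (auto intro: bounded_linear_compose bounded_linear_fst bounded_linear_snd)
  then show ?thesis
    using assms unfolding bounded_clinear_def
    by (auto simp: upper_triangular_op_def case_prod_unfold scaleC_prod_def scaleC_add_right)
qed

lemma shift_op_upper_triangular_op:
  "shift_op (upper_triangular_op A C B) l = upper_triangular_op (shift_op A l) C (shift_op B l)"
  by (auto simp: shift_op_def upper_triangular_op_def scaleC_prod_def)

lemma snd_upper_triangular_op_funpow: "snd ((upper_triangular_op A C B ^^ n) p) = (B ^^ n) (snd p)"
  by (induction n) (auto simp: upper_triangular_op_def case_prod_unfold)

lemma upper_triangular_op_funpow_left: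
  assumes "B 0 = 0" "C 0 = 0"
  shows "(upper_triangular_op A C B ^^ n) (x, 0) = ((A ^^ n) x, 0)"
  using assms by (induction n) (auto simp: upper_triangular_op_def)

section \<open>The SVEP and the spectrum of an upper triangular operator\<close>

lemma vec_analytic_on_bounded_clinear:
  assumes T: "bounded_clinear T" and f: "vec_analytic_on f S"
  shows "vec_analytic_on (\<lambda>z. T (f z)) S"
  unfolding vec_analytic_on_def
proof
  fix z assume "z \<in> S"
  then obtain e where "e > 0" and e: "vec_holomorphic_on f (ball z e)"
    using f by (auto simp: vec_analytic_on_def)
  have "\<exists>d. ((\<lambda>z. T (f z)) has_derivative (\<lambda>h. h *\<^sub>C d)) (at w within ball z e)" if w: "w \<in> ball z e" for w
  proof -
    obtain d where "(f has_derivative (\<lambda>h. h *\<^sub>C d)) (at w within ball z e)"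
      using e w unfolding vec_holomorphic_on_def by blast
    from bounded_linear.has_derivative[OF bounded_clinear_bounded_linear[OF T] this]
    show ?thesis unfolding bounded_clinear_scaleC[OF T] by blast
  qed
  then show "\<exists>e>0. vec_holomorphic_on (\<lambda>z. T (f z)) (ball z e)"
    using \<open>e > 0\<close> unfolding vec_holomorphic_on_def by blast
qed

lemma bounded_clinear_fst: "bounded_clinear fst"
  and bounded_clinear_snd: "bounded_clinear snd"
  by (simp_all add: bounded_clinear_def bounded_linear_fst bounded_linear_snd scaleC_prod_def)

text \<open>The second component of an analytic solution vanishes by the SVEP of \<open>B\<close>.
  This removes the term with \<open>C\<close>, and the SVEP of \<open>A\<close> then handles the
  first component.\<close>

lemma svep_upper_triangular_op:
  assumes A: "svep A" and B: "svep B" and C: "C 0 = 0"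
  shows "svep (upper_triangular_op A C B)"
  unfolding svep_def
proof (intro allI impI ballI, elim conjE)
  fix l r f z
  assume r: "(0::real) < r" and f: "vec_analytic_on f (ball l r)"
    and eq: "\<forall>m\<in>ball l r. shift_op (upper_triangular_op A C B) m (f m) = 0" and z: "z \<in> ball l r"
  have eqs: "shift_op A m (fst (f m)) + C (snd (f m)) = 0 \<and> shift_op B m (snd (f m)) = 0"
    if "m \<in> ball l r" for m
    using eq that unfolding shift_op_upper_triangular_op
    by (auto simp: upper_triangular_op_def case_prod_unfold zero_prod_def)
  have 0: "snd (f m) = 0" if "m \<in> ball l r" for m
    using B r vec_analytic_on_bounded_clinear[OF bounded_clinear_snd f] eqs that
    unfolding svep_def by blast
  have "fst (f m) = 0" if "m \<in> ball l r" for m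
    using A r vec_analytic_on_bounded_clinear[OF bounded_clinear_fst f] eqs 0 C that
    unfolding svep_def by fastforce
  with 0 z show "f z = 0" by (simp add: prod_eq_iff)
qed

text \<open>A bijective triangular operator only gives \<open>?A\<close> injective and
  \<open>?B\<close> surjective at once. The SVEP of \<open>B\<close> upgrades surjectivity of
  \<open>?B\<close> to bijectivity; the preimage of \<open>(u, 0)\<close> then has second component
  0, so \<open>?A\<close> is surjective too.\<close>

lemma bij_upper_triangular_op_iff:
  fixes A :: "'a::complex_banach \<Rightarrow> 'a" and B :: "'b::complex_banach \<Rightarrow> 'b"
  assumes A: "bounded_clinear A" and B: "bounded_clinear B" and C: "bounded_clinear C" and "svep B"
  shows "bij (upper_triangular_op (shift_op A l) C (shift_op B l)) \<longleftrightarrow>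
    bij (shift_op A l) \<and> bij (shift_op B l)"
    (is "bij ?M \<longleftrightarrow> bij ?A \<and> bij ?B")
proof
  have A': "bounded_clinear ?A" and B': "bounded_clinear ?B" using A B by (auto intro: bounded_clinear_shift_op)
  have M: "?M (x, y) = (?A x + C y, ?B y)" for x y by (simp add: upper_triangular_op_def)
  {
    assume "bij ?M"
    then have sM: "\<exists>x y. ?M (x, y) = (u, v)" and iM: "?M p = ?M q \<Longrightarrow> p = q" for u v p q
      unfolding bij_def surj_def by (metis surj_pair, metis injD)
    have "surj ?B" unfolding surj_def using sM M by (metis prod.inject)
    have B0: "y = 0" if "?B y = 0" for y
      using svep_kernel_trivial[OF B \<open>svep B\<close> closed_UNIV complex_vector.subspace_UNIV \<open>surj ?B\<close>] that by blast
    then have "inj ?B" by (intro injI) (metis bounded_clinear_diff[OF B'] eq_iff_diff_eq_0)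
    moreover have "inj ?A"
      by (intro injI) (use iM M in \<open>metis prod.inject\<close>)
    moreover have "surj ?A"
      unfolding surj_def
    proof
      fix u
      obtain x y where xy: "?M (x, y) = (u, 0)" using sM by blast
      then have "y = 0" using B0 M by simp
      then have "?A x = u" using xy M bounded_clinear_zero[OF C] by simp
      then show "\<exists>x. u = ?A x" by blast
    qed
    ultimately show "bij ?A \<and> bij ?B" using \<open>surj ?B\<close> by (simp add: bij_def)
  }
  {
    assume AB: "bij ?A \<and> bij ?B"
    then have inj: "?A x = ?A x' \<Longrightarrow> x = x'" "?B y = ?B y' \<Longrightarrow> y = y'" for x x' y y'
      by (auto simp: bij_def inj_def)
    have "inj ?M" using inj by (auto simp: inj_def M dest!: inj(2))
    moreover have "surj ?M"
      unfolding surj_def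
    proof
      fix p :: "'a \<times> 'b"
      obtain y where y: "snd p = ?B y" using AB by (auto simp: bij_def surj_def)
      obtain x where x: "fst p - C y = ?A x" using AB by (meson bij_def surj_def)
      have "p = ?M (x, y)" unfolding M by (simp add: prod_eq_iff y x[symmetric])
      then show "\<exists>q. p = ?M q" by blast
    qed
    ultimately show "bij ?M" by (simp add: bij_def)
  }
qed

section \<open>Finite ascent and descent of an upper triangular operator\<close>

lemma finite_ascent_descent_eventually:
  fixes T :: "'a::zero \<Rightarrow> 'a"
  assumes "finite_ascent_descent T" "T 0 = 0"
  shows "\<exists>n. \<forall>m\<ge>n. (\<forall>x. (T ^^ Suc m) x = 0 \<longrightarrow> (T ^^ m) x = 0) \<and>
    range (T ^^ m) \<subseteq> range (T ^^ Suc m)"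
proof -
  obtain n where n: "\<And>x. (T ^^ Suc n) x = 0 \<Longrightarrow> (T ^^ n) x = 0" "range (T ^^ n) \<subseteq> range (T ^^ Suc n)"
    using assms(1) by (auto simp: finite_ascent_descent_def)
  have T0: "(T ^^ k) 0 = 0" for k by (induction k) (simp_all add: assms(2))
  have sub: "range (T ^^ (k + n)) \<subseteq> range (T ^^ n)" for k
    unfolding add.commute[of k n] funpow_add by auto
  show ?thesis
  proof (intro exI allI impI conjI)
    fix m assume "m \<ge> n"
    then obtain k where m: "m = k + n" by (metis add.commute le_Suc_ex)
    show "(T ^^ m) x = 0" if "(T ^^ Suc m) x = 0" for x
    proof -
      have "(T ^^ n) x = 0" using ascent_mono[where T = T and n = n and k = "Suc k" and x = x] n(1) that by (simp add: m)
      then show ?thesis by (simp add: m funpow_add T0)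
    qed
    show "range (T ^^ m) \<subseteq> range (T ^^ Suc m)"
      using descent_mono[OF n(2), of "Suc k"] sub[of k] unfolding m by simp
  qed
qed

text \<open>If \<open>n\<close> serves both \<open>A\<close> and \<open>B\<close>, then
  \<open>n + n\<close> serves the triangular operator: the first \<open>n\<close> applications
  reduce the problem to vectors \<open>(z, 0)\<close>, on which the operator acts as
  \<open>A\<close>, and the other \<open>n\<close> are for \<open>A\<close>.\<close>

lemma finite_ascent_descent_upper_triangular_op:
  assumes A: "bounded_clinear A" and B: "bounded_clinear B" and C: "bounded_clinear C"
    and "finite_ascent_descent A" "finite_ascent_descent B"
  shows "finite_ascent_descent (upper_triangular_op A C B)"
proof -
  let ?M = "upper_triangular_op A C B"
  obtain a where a: "\<forall>m\<ge>a. (\<forall>x. (A ^^ Suc m) x = 0 \<longrightarrow> (A ^^ m) x = 0) \<and>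
    range (A ^^ m) \<subseteq> range (A ^^ Suc m)"
    using finite_ascent_descent_eventually[OF assms(4) bounded_clinear_zero[OF A]] by blast
  obtain b where b: "\<forall>m\<ge>b. (\<forall>x. (B ^^ Suc m) x = 0 \<longrightarrow> (B ^^ m) x = 0) \<and>
    range (B ^^ m) \<subseteq> range (B ^^ Suc m)"
    using finite_ascent_descent_eventually[OF assms(5) bounded_clinear_zero[OF B]] by blast
  define n where "n = max a b"
  have An: "\<And>x. (A ^^ Suc n) x = 0 \<Longrightarrow> (A ^^ n) x = 0" "range (A ^^ n) \<subseteq> range (A ^^ Suc n)"
    and Bn: "\<And>x. (B ^^ Suc n) x = 0 \<Longrightarrow> (B ^^ n) x = 0" "range (B ^^ n) \<subseteq> range (B ^^ Suc n)"
    using a[rule_format, of n] b[rule_format, of n] by (auto simp: n_def)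
  have M: "bounded_clinear (?M ^^ k)" for k
    by (intro bounded_clinear_funpow bounded_clinear_upper_triangular_op A B C)
  have left: "(?M ^^ k) (x, 0) = ((A ^^ k) x, 0)" for k x
    by (intro upper_triangular_op_funpow_left bounded_clinear_zero B C)
  have "(?M ^^ (n + n)) p = 0" if p: "(?M ^^ Suc (n + n)) p = 0" for p
  proof -
    have "(B ^^ (Suc n + n)) (snd p) = 0"
      using p snd_upper_triangular_op_funpow[of "Suc (n + n)" A C B p] by simp
    then have "(B ^^ n) (snd p) = 0" using Bn(1) by (rule ascent_mono[rotated])
    then obtain z where z: "(?M ^^ n) p = (z, 0)"
      using snd_upper_triangular_op_funpow[of n A C B p] by (metis prod.collapse)
    have "(?M ^^ (Suc n + n)) p = ((A ^^ Suc n) z, 0)"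
      unfolding funpow_add o_apply z left ..
    then have "(A ^^ n) z = 0" using p An(1)[of z] by (simp add: zero_prod_def)
    then show ?thesis unfolding funpow_add o_apply z left by (simp add: zero_prod_def)
  qed
  moreover have "(?M ^^ (n + n)) p \<in> range (?M ^^ Suc (n + n))" for p
  proof -
    obtain y where y: "(B ^^ n) (snd p) = (B ^^ Suc n) y" using Bn(2) by blast
    \<comment> \<open>By the choice of \<open>y\<close> the second components cancel, so
      \<open>(?M ^^ n) q\<close> can be treated by the descent of \<open>A\<close>. The correction
      contributes \<open>(0, y)\<close> to the final preimage \<open>(w, y)\<close>.\<close>
    define q where "q = (?M ^^ n) p - (?M ^^ Suc n) (0, y)"
    have "snd q = 0" by (simp only: q_def snd_diff snd_upper_triangular_op_funpow y snd_conv diff_self)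
    then obtain z where z: "q = (z, 0)" by (metis prod.collapse)
    have "(A ^^ n) z \<in> range (A ^^ (Suc n + n))" using descent_mono[OF An(2), of "Suc n"] by blast
    then obtain w where w: "(A ^^ n) z = (A ^^ (Suc n + n)) w" by blast
    have "(?M ^^ n) q = (?M ^^ (Suc n + n)) (w, 0)" unfolding z left w ..
    then have "(?M ^^ n) ((?M ^^ n) p) = (?M ^^ (Suc n + n)) (w, 0) + (?M ^^ n) ((?M ^^ Suc n) (0, y))"
      by (simp add: q_def bounded_clinear_diff[OF M] algebra_simps del: funpow.simps)
    also have "(?M ^^ n) ((?M ^^ Suc n) (0, y)) = (?M ^^ (Suc n + n)) (0, y)"
      unfolding add.commute[of "Suc n" n] funpow_add by simp
    also have "(?M ^^ (Suc n + n)) (w, 0) + (?M ^^ (Suc n + n)) (0, y) = (?M ^^ (Suc n + n)) (w, y)"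
      by (simp add: bounded_clinear_add[OF M, symmetric] del: funpow.simps)
    finally show ?thesis by (auto simp: funpow_add)
  qed
  ultimately show ?thesis unfolding finite_ascent_descent_def by blast
qed

text \<open>The isolation hypothesis is conditional because an isolated point of the union of two
  spectra may be missing from one of them. There the shifted operator is bijective; otherwise
  \<open>isoloid\<close> supplies an eigenvalue and generalized Weyl's theorem makes the shift
  B-Weyl.\<close>

lemma isoloid_finite_ascent_descent:
  fixes T :: "'a::complex_banach \<Rightarrow> 'a"
  assumes T: "bounded_clinear T" and "isoloid T" "svep T" "generalized_weyl T"
    and iso: "l \<in> spectrum T \<Longrightarrow> l isolated_in spectrum T"
  shows "finite_ascent_descent (shift_op T l)"
proof (cases "l \<in> spectrum T")
  case True
  then have "l \<in> isolated_eigenvalues T"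
    using iso \<open>isoloid T\<close> by (simp add: isoloid_def isolated_eigenvalues_def)
  then have "b_weyl (shift_op T l)"
    using \<open>generalized_weyl T\<close> by (auto simp: generalized_weyl_def b_weyl_spectrum_def)
  then show ?thesis by (rule svep_b_weyl_finite_ascent_descent[OF T \<open>svep T\<close>])
next
  case False
  then show ?thesis
    using not_in_spectrum_iff_bij[OF T] bounded_clinear_zero[OF bounded_clinear_shift_op[OF T]]
    by (intro bij_finite_ascent_descent) auto
qed

theorem theorem3p2:
  fixes A :: "'a::complex_banach \<Rightarrow> 'a"
    and B :: "'b::complex_banach \<Rightarrow> 'b"
  assumes "bounded_clinear A" and "bounded_clinear B"
    and "isoloid A" and "isoloid B"
    and "svep A" and "svep B"
    and "generalized_weyl A" and "generalized_weyl B"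
  shows "\<forall>C :: 'b \<Rightarrow> 'a. bounded_clinear C \<longrightarrow>
    generalized_weyl (upper_triangular_op A C B)"
proof (intro allI impI)
  fix C :: "'b \<Rightarrow> 'a" assume C: "bounded_clinear C"
  note A = assms(1) and B = assms(2)
  let ?M = "upper_triangular_op A C B"
  have M: "bounded_clinear ?M" using A B C by (rule bounded_clinear_upper_triangular_op)
  have spec: "spectrum ?M = spectrum A \<union> spectrum B"
    using bij_upper_triangular_op_iff[OF A B C assms(6)] not_in_spectrum_iff_bij[OF A]
      not_in_spectrum_iff_bij[OF B] not_in_spectrum_iff_bij[OF M]
    unfolding shift_op_upper_triangular_op by blast
  have svepM: "svep ?M"
    using assms(5,6) bounded_clinear_zero[OF C] by (rule svep_upper_triangular_op)
  have fin: "finite_ascent_descent (shift_op ?M l)" if iso: "l isolated_in spectrum ?M" for l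
  proof -
    have "l isolated_in spectrum A" if "l \<in> spectrum A"
      using iso that unfolding spec isolated_in_dist_Ex_iff by blast
    then have "finite_ascent_descent (shift_op A l)"
      using A assms(3,5,7) by (intro isoloid_finite_ascent_descent)
    moreover have "l isolated_in spectrum B" if "l \<in> spectrum B"
      using iso that unfolding spec isolated_in_dist_Ex_iff by blast
    then have "finite_ascent_descent (shift_op B l)"
      using B assms(4,6,8) by (intro isoloid_finite_ascent_descent)
    ultimately show ?thesis
      unfolding shift_op_upper_triangular_op
      by (intro finite_ascent_descent_upper_triangular_op bounded_clinear_shift_op A B C)
  qed
  \<comment> \<open>This is the inclusion that uses the hypotheses on \<open>A\<close> and
    \<open>B\<close> beyond the SVEP; the other one follows from the SVEP of \<open>?M\<close>
    alone.\<close>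
  have "l \<notin> b_weyl_spectrum ?M" if "l \<in> isolated_eigenvalues ?M" for l
    using that fin[of l] finite_ascent_descent_b_weyl[OF bounded_clinear_shift_op[OF M]]
    by (simp add: isolated_eigenvalues_def b_weyl_spectrum_def)
  then show "generalized_weyl ?M"
    using svep_b_weyl_isolated_eigenvalue[OF M svepM] b_weyl_spectrum_subset_spectrum[OF M]
    unfolding generalized_weyl_def by blast
qed

end
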